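(* Let $W$ be an irreducible finite complex (pseudo-)reflection group which is not a 2-reflection group. If $\mathcal{U}\subset\mathcal{S}$ generates $W$, then $\mathcal{H}(\mathcal{U})$ and $\mathcal{H}(\tilde{\mathcal{U}})$ are reductive Lie algebras, and $\mathcal{H}(\tilde{\mathcal{U}})'=\mathcal{H}'$.
   Context: Let $V$ be a finite-dimensional complex vector space and $W<\mathrm{GL}(V)$ a finite group generated by (pseudo-)reflections, i.e. invertible endomorphisms $\neq 1$ fixing some hyperplane pointwise. $\mathcal{R}$ is the set of (pseudo-)reflections of $W$; $W$ is a 2-reflection group if $s^2=1$ for all $s\in\mathcal{R}$. $\mathbf{k}$ is a field of characteristic 0. The group algebra $\mathbf{k}W$ is a Lie algebra for $[x,y]=xy-yx$, and $\mathfrak{g}'=[\mathfrak{g},\mathfrak{g}]$ for a Lie subalgebra $\mathfrak{g}$. $\mathcal{S}\subset\mathcal{R}$ is a subset stable under $W$-conjugation such that $s\mapsto\mathrm{Ker}(s-1)$ is a bijection from $\mathcal{S}$ onto the set of reflecting hyperplanes. For $\mathcal{U}\subset\mathcal{S}$ (not necessarily stable under conjugation), $\tilde{\mathcal{U}}=\{s^k : s\in\mathcal{U},\ s^k\ne 1\}\subset\mathcal{R}$, and $\mathcal{H}(\mathcal{U})$, $\mathcal{H}(\tilde{\mathcal{U}})$ are the Lie subalgebras of $\mathbf{k}W$ generated by $\mathcal{U}$ and $\tilde{\mathcal{U}}$ respectively. $\mathcal{H}$ is the Lie subalgebra of $\mathbf{k}W$ generated by $\mathcal{R}$. *)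

theory Defs
  imports Complex_Main "HOL-Algebra.Generated_Groups" "HOL-Library.Poly_Mapping"
begin

section \<open>Lie algebras\<close>

locale lie_algebra = vector_space scale
  for scale :: "'k::field \<Rightarrow> 'b::ab_group_add \<Rightarrow> 'b" +
  fixes bracket :: "'b \<Rightarrow> 'b \<Rightarrow> 'b"
  assumes bracket_add_left: "bracket (x + y) z = bracket x z + bracket y z"
    and bracket_add_right: "bracket x (y + z) = bracket x y + bracket x z"
    and bracket_scale_left: "bracket (scale c x) y = scale c (bracket x y)"
    and bracket_scale_right: "bracket x (scale c y) = scale c (bracket x y)"
    and bracket_self: "bracket x x = 0"
    and jacobi: "bracket x (bracket y z) + bracket y (bracket z x) + bracket z (bracket x y) = 0"
begin

definition lie_subalgebra :: "'b set \<Rightarrow> bool" where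
  "lie_subalgebra L \<longleftrightarrow> subspace L \<and> (\<forall>x\<in>L. \<forall>y\<in>L. bracket x y \<in> L)"

definition lie_ideal :: "'b set \<Rightarrow> 'b set \<Rightarrow> bool" where
  "lie_ideal I L \<longleftrightarrow> subspace I \<and> I \<subseteq> L \<and> (\<forall>x\<in>L. \<forall>y\<in>I. bracket x y \<in> I)"

text \<open>The Lie subalgebra of \<open>A\<close> generated by \<open>S\<close>, for \<open>S\<close> a subset of the Lie subalgebra \<open>A\<close>.\<close>

definition lie_generated :: "'b set \<Rightarrow> 'b set \<Rightarrow> 'b set" where
  "lie_generated A S = \<Inter>{L. lie_subalgebra L \<and> L \<subseteq> A \<and> S \<subseteq> L}"

definition derived :: "'b set \<Rightarrow> 'b set" where
  "derived L = span {bracket x y | x y. x \<in> L \<and> y \<in> L}"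

definition lie_solvable :: "'b set \<Rightarrow> bool" where
  "lie_solvable L \<longleftrightarrow> (\<exists>n. (derived ^^ n) L = {0})"

definition center :: "'b set \<Rightarrow> 'b set" where
  "center L = {x \<in> L. \<forall>y\<in>L. bracket x y = 0}"

text \<open>The sum of all solvable ideals; if \<open>L\<close> has finite dimension, this is the largest solvable
  ideal of \<open>L\<close>.\<close>

definition radical :: "'b set \<Rightarrow> 'b set" where
  "radical L = span (\<Union>{I. lie_ideal I L \<and> lie_solvable I})"

text \<open>Only meant for \<open>L\<close> of finite dimension over a field of characteristic 0. There the condition
  is equivalent to semisimplicity of the adjoint representation of \<open>L\<close>.\<close>

definition reductive :: "'b set \<Rightarrow> bool" where
  "reductive L \<longleftrightarrow> lie_subalgebra L \<and> radical L = center L"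

end


section \<open>Group algebras of transformation groups\<close>

text \<open>The finite formal linear combinations of self-maps of \<open>'a\<close> form the monoid algebra of
  \<^term>\<open>(\<circ>)\<close>. The group algebra of a group \<open>W\<close> of permutations of \<open>'a\<close> is its subalgebra of
  combinations supported on \<open>W\<close>; the product there does not depend on \<open>W\<close>.\<close>

definition ga_scale :: "'k::field \<Rightarrow> (('a \<Rightarrow> 'a) \<Rightarrow>\<^sub>0 'k) \<Rightarrow> (('a \<Rightarrow> 'a) \<Rightarrow>\<^sub>0 'k)" where
  "ga_scale c x = Poly_Mapping.map ((*) c) x"

definition ga_mult :: "(('a \<Rightarrow> 'a) \<Rightarrow>\<^sub>0 'k::field) \<Rightarrow> (('a \<Rightarrow> 'a) \<Rightarrow>\<^sub>0 'k) \<Rightarrow> (('a \<Rightarrow> 'a) \<Rightarrow>\<^sub>0 'k)" where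
  "ga_mult x y = (\<Sum>f\<in>Poly_Mapping.keys x. \<Sum>g\<in>Poly_Mapping.keys y.
     Poly_Mapping.single (f \<circ> g) (Poly_Mapping.lookup x f * Poly_Mapping.lookup y g))"

definition ga_bracket :: "(('a \<Rightarrow> 'a) \<Rightarrow>\<^sub>0 'k::field) \<Rightarrow> (('a \<Rightarrow> 'a) \<Rightarrow>\<^sub>0 'k) \<Rightarrow> (('a \<Rightarrow> 'a) \<Rightarrow>\<^sub>0 'k)" where
  "ga_bracket x y = ga_mult x y - ga_mult y x"

definition group_algebra :: "('a \<Rightarrow> 'a) set \<Rightarrow> (('a \<Rightarrow> 'a) \<Rightarrow>\<^sub>0 'k::field) set" where
  "group_algebra W = {x. Poly_Mapping.keys x \<subseteq> W}"

lemma lookup_ga_scale: "Poly_Mapping.lookup (ga_scale c x) f = c * Poly_Mapping.lookup x f"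
  by (simp add: ga_scale_def Poly_Mapping.map.rep_eq when_def)

lemma ga_mult_superset:
  assumes "finite A" "finite B" "Poly_Mapping.keys x \<subseteq> A" "Poly_Mapping.keys y \<subseteq> B"
  shows "ga_mult x y = (\<Sum>f\<in>A. \<Sum>g\<in>B.
    Poly_Mapping.single (f \<circ> g) (Poly_Mapping.lookup x f * Poly_Mapping.lookup y g))"
proof -
  have "ga_mult x y = (\<Sum>f\<in>Poly_Mapping.keys x. \<Sum>g\<in>B.
      Poly_Mapping.single (f \<circ> g) (Poly_Mapping.lookup x f * Poly_Mapping.lookup y g))"
    unfolding ga_mult_def
    by (intro sum.cong refl sum.mono_neutral_left) (use assms in \<open>auto simp: in_keys_iff\<close>)
  also have "\<dots> = (\<Sum>f\<in>A. \<Sum>g\<in>B.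
      Poly_Mapping.single (f \<circ> g) (Poly_Mapping.lookup x f * Poly_Mapping.lookup y g))"
    by (intro sum.mono_neutral_left) (use assms in \<open>auto simp: in_keys_iff\<close>)
  finally show ?thesis .
qed

lemma ga_mult_add_left: "ga_mult (x + y) z = ga_mult x z + ga_mult y z"
proof -
  let ?A = "Poly_Mapping.keys x \<union> Poly_Mapping.keys y" and ?B = "Poly_Mapping.keys z"
  have "Poly_Mapping.keys (x + y) \<subseteq> ?A" by (rule Poly_Mapping.keys_add)
  then show ?thesis
    by (simp add: ga_mult_superset[of ?A ?B] lookup_add distrib_right single_add sum.distrib)
qed

lemma ga_mult_add_right: "ga_mult z (x + y) = ga_mult z x + ga_mult z y"
proof -
  let ?A = "Poly_Mapping.keys x \<union> Poly_Mapping.keys y" and ?B = "Poly_Mapping.keys z"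
  have "Poly_Mapping.keys (x + y) \<subseteq> ?A" by (rule Poly_Mapping.keys_add)
  then show ?thesis
    by (simp add: ga_mult_superset[of ?B ?A] lookup_add distrib_left single_add sum.distrib)
qed

lemma ga_scale_vector_space: "vector_space (ga_scale :: 'k::field \<Rightarrow> (('a \<Rightarrow> 'a) \<Rightarrow>\<^sub>0 'k) \<Rightarrow> _)"
  by unfold_locales
    (auto intro!: poly_mapping_eqI simp: lookup_ga_scale lookup_add algebra_simps)

lemma ga_scale_single: "ga_scale c (Poly_Mapping.single f d) = Poly_Mapping.single f (c * d)"
  by (auto intro!: poly_mapping_eqI simp: lookup_ga_scale lookup_single when_def)

lemma ga_scale_sum: "ga_scale c (sum h A) = (\<Sum>a\<in>A. ga_scale c (h a))"
  by (rule poly_mapping_eqI) (simp add: lookup_ga_scale lookup_sum sum_distrib_left)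

lemma keys_ga_scale: "Poly_Mapping.keys (ga_scale c x) \<subseteq> Poly_Mapping.keys x"
  by (auto simp: in_keys_iff lookup_ga_scale)

lemma ga_mult_scale_left: "ga_mult (ga_scale c x) y = ga_scale c (ga_mult x y)"
  by (simp add: ga_mult_superset[of "Poly_Mapping.keys x" "Poly_Mapping.keys y"] keys_ga_scale
      lookup_ga_scale ga_scale_sum ga_scale_single mult.assoc)

lemma ga_mult_scale_right: "ga_mult x (ga_scale c y) = ga_scale c (ga_mult x y)"
  by (simp add: ga_mult_superset[of "Poly_Mapping.keys x" "Poly_Mapping.keys y"] keys_ga_scale
      lookup_ga_scale ga_scale_sum ga_scale_single mult.left_commute)

lemma ga_mult_zero: "ga_mult 0 x = 0" "ga_mult x 0 = 0"
  by (simp_all add: ga_mult_def)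

lemma ga_mult_single:
  "ga_mult (Poly_Mapping.single f c) (Poly_Mapping.single g d) = Poly_Mapping.single (f \<circ> g) (c * d)"
  by (simp add: ga_mult_superset[of "{f}" "{g}"])

lemma ga_mult_sum_left: "ga_mult (sum h A) x = (\<Sum>a\<in>A. ga_mult (h a) x)"
  by (induction A rule: infinite_finite_induct) (simp_all add: ga_mult_zero ga_mult_add_left)

lemma ga_mult_sum_right: "ga_mult x (sum h A) = (\<Sum>a\<in>A. ga_mult x (h a))"
  by (induction A rule: infinite_finite_induct) (simp_all add: ga_mult_zero ga_mult_add_right)

lemma ga_sum_single:
  "x = (\<Sum>f\<in>Poly_Mapping.keys x. Poly_Mapping.single f (Poly_Mapping.lookup x f))"
  by (rule poly_mapping_eqI)
    (auto simp: lookup_sum lookup_single when_def in_keys_iff sum.delta)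

lemma ga_mult_assoc: "ga_mult (ga_mult x y) z = ga_mult x (ga_mult y z)"
proof -
  let ?s = "\<lambda>x. \<Sum>f\<in>Poly_Mapping.keys x. Poly_Mapping.single f (Poly_Mapping.lookup x f)"
  have "ga_mult (ga_mult (?s x) (?s y)) (?s z) = ga_mult (?s x) (ga_mult (?s y) (?s z))"
    by (simp only: ga_mult_sum_left ga_mult_sum_right ga_mult_single mult.assoc comp_assoc)
  then show ?thesis by (simp flip: ga_sum_single)
qed

lemma ga_mult_diff_left: "ga_mult (x - y) z = ga_mult x z - ga_mult y z"
  using ga_mult_add_left[of "x - y" y z] by simp

lemma ga_mult_diff_right: "ga_mult z (x - y) = ga_mult z x - ga_mult z y"
  using ga_mult_add_right[of z "x - y" y] by simp

interpretation ga: lie_algebra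
  "ga_scale :: 'k::field \<Rightarrow> (('a \<Rightarrow> 'a) \<Rightarrow>\<^sub>0 'k) \<Rightarrow> (('a \<Rightarrow> 'a) \<Rightarrow>\<^sub>0 'k)" ga_bracket
proof (intro lie_algebra.intro ga_scale_vector_space lie_algebra_axioms.intro)
  interpret vector_space "ga_scale :: 'k \<Rightarrow> (('a \<Rightarrow> 'a) \<Rightarrow>\<^sub>0 'k) \<Rightarrow> _"
    by (rule ga_scale_vector_space)
  fix x y z :: "('a \<Rightarrow> 'a) \<Rightarrow>\<^sub>0 'k" and c
  show "ga_bracket (x + y) z = ga_bracket x z + ga_bracket y z"
    and "ga_bracket x (y + z) = ga_bracket x y + ga_bracket x z"
    by (simp_all add: ga_bracket_def ga_mult_add_left ga_mult_add_right)
  show "ga_bracket (ga_scale c x) y = ga_scale c (ga_bracket x y)"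
    and "ga_bracket x (ga_scale c y) = ga_scale c (ga_bracket x y)"
    by (simp_all add: ga_bracket_def ga_mult_scale_left ga_mult_scale_right scale_right_diff_distrib)
  show "ga_bracket x x = 0"
    by (simp add: ga_bracket_def)
  show "ga_bracket x (ga_bracket y z) + ga_bracket y (ga_bracket z x)
      + ga_bracket z (ga_bracket x y) = 0"
    by (simp add: ga_bracket_def ga_mult_diff_left ga_mult_diff_right ga_mult_assoc)
qed

lemma lie_subalgebra_group_algebra:
  assumes "\<And>f g. f \<in> W \<Longrightarrow> g \<in> W \<Longrightarrow> f \<circ> g \<in> W"
  shows "ga.lie_subalgebra (group_algebra W :: (('a \<Rightarrow> 'a) \<Rightarrow>\<^sub>0 'k::field) set)"
proof -
  let ?A = "group_algebra W :: (('a \<Rightarrow> 'a) \<Rightarrow>\<^sub>0 'k) set"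
  have sub: "ga.subspace ?A"
    using keys_ga_scale Poly_Mapping.keys_add
    by (intro ga.subspaceI) (fastforce simp: group_algebra_def)+
  have "ga_mult x y \<in> ?A" if "x \<in> ?A" "y \<in> ?A" for x y
    unfolding ga_mult_def
    by (intro ga.subspace_sum[OF sub]) (use that assms in \<open>auto simp: group_algebra_def\<close>)
  then show ?thesis
    using sub by (auto simp: ga.lie_subalgebra_def ga_bracket_def intro: ga.subspace_diff)
qed

definition lie_closure_in_group_algebra ::
    "('a \<Rightarrow> 'a) set \<Rightarrow> ('a \<Rightarrow> 'a) set \<Rightarrow> (('a \<Rightarrow> 'a) \<Rightarrow>\<^sub>0 'k::field) set" where
  "lie_closure_in_group_algebra W U =
     ga.lie_generated (group_algebra W) ((\<lambda>s. Poly_Mapping.single s 1) ` U)"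


section \<open>Pseudo-reflection groups\<close>

definition GL :: "('k::field \<Rightarrow> 'v::ab_group_add \<Rightarrow> 'v) \<Rightarrow> ('v \<Rightarrow> 'v) monoid" where
  "GL scale = \<lparr>carrier = {f. Vector_Spaces.linear scale scale f \<and> bij f}, mult = (\<circ>), one = id\<rparr>"

definition hyperplane :: "('k::field \<Rightarrow> 'v::ab_group_add \<Rightarrow> 'v) \<Rightarrow> 'v set \<Rightarrow> bool" where
  "hyperplane scale H \<longleftrightarrow> module.subspace scale H \<and>
     Suc (vector_space.dim scale H) = vector_space.dim scale UNIV"

definition pseudo_reflection :: "('k::field \<Rightarrow> 'v::ab_group_add \<Rightarrow> 'v) \<Rightarrow> ('v \<Rightarrow> 'v) \<Rightarrow> bool" where
  "pseudo_reflection scale s \<longleftrightarrow> s \<in> carrier (GL scale) \<and> s \<noteq> id \<and>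
     (\<exists>H. hyperplane scale H \<and> (\<forall>v\<in>H. s v = v))"

definition reflections :: "('k::field \<Rightarrow> 'v::ab_group_add \<Rightarrow> 'v) \<Rightarrow> ('v \<Rightarrow> 'v) set \<Rightarrow> ('v \<Rightarrow> 'v) set" where
  "reflections scale W = {s \<in> W. pseudo_reflection scale s}"

definition reflection_group :: "('k::field \<Rightarrow> 'v::ab_group_add \<Rightarrow> 'v) \<Rightarrow> ('v \<Rightarrow> 'v) set \<Rightarrow> bool" where
  "reflection_group scale W \<longleftrightarrow> subgroup W (GL scale) \<and> finite W \<and>
     generate (GL scale) (reflections scale W) = W"

definition irreducible_group :: "('k::field \<Rightarrow> 'v::ab_group_add \<Rightarrow> 'v) \<Rightarrow> ('v \<Rightarrow> 'v) set \<Rightarrow> bool" where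
  "irreducible_group scale W \<longleftrightarrow> (UNIV :: 'v set) \<noteq> {0} \<and>
     (\<forall>X. module.subspace scale X \<and> (\<forall>w\<in>W. w ` X \<subseteq> X) \<longrightarrow> X = {0} \<or> X = UNIV)"

definition two_reflection_group :: "('k::field \<Rightarrow> 'v::ab_group_add \<Rightarrow> 'v) \<Rightarrow> ('v \<Rightarrow> 'v) set \<Rightarrow> bool" where
  "two_reflection_group scale W \<longleftrightarrow> reflection_group scale W \<and>
     (\<forall>s\<in>reflections scale W. s \<circ> s = id)"

definition fixed_space :: "('v \<Rightarrow> 'v::ab_group_add) \<Rightarrow> 'v set" where
  "fixed_space s = {v. s v - v = 0}"

definition reflecting_hyperplanes ::
    "('k::field \<Rightarrow> 'v::ab_group_add \<Rightarrow> 'v) \<Rightarrow> ('v \<Rightarrow> 'v) set \<Rightarrow> 'v set set" where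
  "reflecting_hyperplanes scale W = fixed_space ` reflections scale W"

definition conj_stable :: "('k::field \<Rightarrow> 'v::ab_group_add \<Rightarrow> 'v) \<Rightarrow> ('v \<Rightarrow> 'v) set \<Rightarrow> ('v \<Rightarrow> 'v) set \<Rightarrow> bool" where
  "conj_stable scale W S \<longleftrightarrow>
     (\<forall>w\<in>W. \<forall>s\<in>S. w \<otimes>\<^bsub>GL scale\<^esub> s \<otimes>\<^bsub>GL scale\<^esub> inv\<^bsub>GL scale\<^esub> w \<in> S)"

text \<open>For maps of finite order, natural and integer exponents give the same powers.\<close>

definition nontrivial_powers :: "('v \<Rightarrow> 'v) set \<Rightarrow> ('v \<Rightarrow> 'v) set" where
  "nontrivial_powers U = {s ^^ k | s k. s \<in> U \<and> s ^^ k \<noteq> id}"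

end

theory Submission
  imports Defs
begin

text \<open>Write \<open>kW\<close> for the group algebra, \<open>P\<close> for the set of nontrivial powers of elements of \<open>U\<close>, and
\<open>H(X)\<close> for the Lie subalgebra of \<open>kW\<close> generated by \<open>X\<close>.

\<^bold>\<open>Reductivity.\<close> If \<open>X\<close> generates \<open>W\<close>, then \<open>H(X)\<close> generates \<open>kW\<close> as an associative algebra, and \<open>kW\<close>
is semisimple, so \<open>H(X)\<close> has a faithful semisimple representation. Since \<open>k\<close> need not be
algebraically closed, Lie's theorem is avoided: for an abelian ideal \<open>I\<close> of \<open>H(X)\<close>, the commutators
\<open>z = [a, b]\<close> with \<open>a\<close> in \<open>H(X)\<close> and \<open>b\<close> in \<open>I\<close> commute with each other, and they are nilpotent, because
applying the derivation \<open>[a, -]\<close> repeatedly to a polynomial relation for \<open>b\<close> lowers its degree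
at the price of powers of \<open>z\<close> (\<open>nilpotent_commutator\<close>). The common kernel of these \<open>z\<close> is a left
ideal of \<open>kW\<close>. By Maschke it has a complement that is again a left ideal; commuting nilpotents
have a common kernel vector in any nonzero space they preserve, so the complement is zero and
all \<open>z\<close> vanish (\<open>commuting_nilpotent_ideal_trivial\<close>). Hence abelian ideals are central. The same
argument shows that the derived series of a solvable ideal cannot have a nonzero central term
beyond its start, so solvable ideals are abelian and central.

\<^bold>\<open>Stability under conjugation.\<close> Let \<open>s\<close> have order \<open>e\<close> and let \<open>L\<close> be a Lie subalgebra containing
its nontrivial powers. Left and right multiplication by \<open>s\<close> commute, and on a common eigenvector
with eigenvalues \<open>x\<close> and \<open>y\<close> the operators \<open>[s^k, -]\<close> have eigenvalues \<open>x^k - y^k\<close>. By independence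
of characters of a cyclic group these numbers determine \<open>x\<close> and \<open>y\<close> unless \<open>x = y\<close>, when
conjugation by \<open>s\<close> acts trivially. So conjugation is a polynomial in the operators \<open>[s^k, -]\<close>, and
it preserves \<open>L\<close>; the proof uses explicit polynomials, which are defined over the rationals
(\<open>conjugation_by_cyclic_group\<close>). Consequently \<open>H(P)\<close> is stable under conjugation by \<open>W\<close>.

\<^bold>\<open>All reflections are conjugate to elements of\<close> \<open>P\<close>. For a \<open>W\<close>-orbit \<open>C\<close> of hyperplanes, the product
\<open>F\<close> of linear forms defining them is multiplied by a scalar under each element of \<open>W\<close>. Under a
reflection whose hyperplane lies outside \<open>C\<close>, \<open>F\<close> is invariant, as one sees by evaluating at a
generic point of that hyperplane; under one whose hyperplane lies in \<open>C\<close>, \<open>F\<close> is multiplied by the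
nontrivial eigenvalue of the reflection. Let \<open>r\<close> be a reflection, \<open>C\<close> the orbit of its hyperplane, and
\<open>s\<close> the element of \<open>S\<close> with the same hyperplane. The elements of \<open>U\<close> with hyperplane in \<open>C\<close> are
conjugate to \<open>s\<close>, so, \<open>U\<close> being a generating set, the eigenvalue of \<open>r\<close> is a power of that of \<open>s\<close>, and
\<open>r\<close> is the same power of \<open>s\<close> (\<open>reflection_conjugate_to_generator_power\<close>).

Together, the last two points give the equality \<open>H(P) = H\<close>, which is stronger than the
equality of the derived algebras.\<close>

section \<open>Group algebras of finite permutation groups\<close>

notation ga_mult (infixl "\<star>" 70)

abbreviation gelem :: "('a \<Rightarrow> 'a) \<Rightarrow> (('a \<Rightarrow> 'a) \<Rightarrow>\<^sub>0 'k::field)" where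
  "gelem g \<equiv> Poly_Mapping.single g 1"

primrec ga_power :: "(('a \<Rightarrow> 'a) \<Rightarrow>\<^sub>0 'k::field) \<Rightarrow> nat \<Rightarrow> (('a \<Rightarrow> 'a) \<Rightarrow>\<^sub>0 'k)" where
  "ga_power x 0 = gelem id"
| "ga_power x (Suc n) = x \<star> ga_power x n"

lemma gelem_mult: "gelem f \<star> gelem g = gelem (f \<circ> g)"
  by (simp add: ga_mult_single)

lemma ga_mult_id_left [simp]: "gelem id \<star> x = x"
  by (subst (2) ga_sum_single, subst ga_sum_single[of x])
    (simp add: ga_mult_sum_right ga_mult_single)

lemma ga_mult_id_right [simp]: "x \<star> gelem id = x"
  by (subst (2) ga_sum_single, subst ga_sum_single[of x])
    (simp add: ga_mult_sum_left ga_mult_single)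

lemma ga_power_commute: "x \<star> y = y \<star> x \<Longrightarrow> ga_power x n \<star> y = y \<star> ga_power x n"
  by (induction n) (simp_all add: ga_mult_assoc, simp flip: ga_mult_assoc)

lemma ga_bracket_eq_0_iff: "ga_bracket x y = 0 \<longleftrightarrow> x \<star> y = y \<star> x"
  by (simp add: ga_bracket_def)

lemma group_algebra_subspace: "ga.subspace (group_algebra W)"
proof (rule ga.subspaceI)
  show "0 \<in> group_algebra W"
    by (simp add: group_algebra_def)
  show "x + y \<in> group_algebra W" if "x \<in> group_algebra W" "y \<in> group_algebra W" for x y
    using that Poly_Mapping.keys_add[of x y] unfolding group_algebra_def by blast
  show "ga_scale c x \<in> group_algebra W" if "x \<in> group_algebra W" for c x
    using that keys_ga_scale[of c x] unfolding group_algebra_def by blast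
qed

lemma gelem_in_group_algebra [simp]: "gelem g \<in> group_algebra W \<longleftrightarrow> g \<in> W"
  by (simp add: group_algebra_def)

lemma group_algebra_eq_span: "group_algebra W = ga.span (gelem ` W)"
proof
  show "ga.span (gelem ` W) \<subseteq> group_algebra W"
    by (rule ga.span_minimal) (auto simp: group_algebra_subspace)
  show "group_algebra W \<subseteq> ga.span (gelem ` W :: (('a \<Rightarrow> 'a) \<Rightarrow>\<^sub>0 'k::field) set)"
  proof
    fix x :: "('a \<Rightarrow> 'a) \<Rightarrow>\<^sub>0 'k"
    assume x: "x \<in> group_algebra W"
    have "(\<Sum>f\<in>Poly_Mapping.keys x. ga_scale (Poly_Mapping.lookup x f) (gelem f))
      \<in> ga.span (gelem ` W)"
      using x by (intro ga.span_sum ga.span_scale ga.span_base) (auto simp: group_algebra_def)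
    then show "x \<in> ga.span (gelem ` W)"
      by (simp add: ga_scale_single flip: ga_sum_single)
  qed
qed

locale finite_permutation_group =
  fixes W :: "('a \<Rightarrow> 'a) set"
  assumes finite_W: "finite W"
    and id_in_W: "id \<in> W"
    and comp_in_W: "\<And>f g. f \<in> W \<Longrightarrow> g \<in> W \<Longrightarrow> f \<circ> g \<in> W"
    and bij_W: "\<And>f. f \<in> W \<Longrightarrow> bij f"
begin

lemma power_in_W: "w \<in> W \<Longrightarrow> w ^^ n \<in> W"
  by (induction n) (auto simp: id_in_W comp_in_W)

text \<open>Two powers of \<open>w\<close> coincide, and \<open>w\<close> can be cancelled. In particular the inverse of \<open>w\<close> is one of its
powers, so it lies in \<open>W\<close>.\<close>

lemma finite_order:
  assumes "w \<in> W"
  obtains n where "n > 0" "w ^^ n = id"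
proof -
  have "\<not> inj (\<lambda>n. w ^^ n)"
    using finite_W power_in_W[OF assms] by (meson finite_subset image_subsetI infinite_UNIV_nat finite_imageD)
  then obtain m n where mn: "w ^^ m = w ^^ n" "m < n"
    by (metis injI linorder_neqE_nat)
  have "w ^^ m \<circ> w ^^ (n - m) = w ^^ m \<circ> id"
    using mn funpow_add[of m "n - m" w] by simp
  then have "w ^^ (n - m) = id"
    using bij_W[OF power_in_W[OF assms], of m] by (metis bij_is_inj fun.inj_map inj_eq)
  then show thesis
    using mn that[of "n - m"] by simp
qed

lemma inverse_in_W:
  assumes "w \<in> W"
  obtains v where "v \<in> W" "v \<circ> w = id" "w \<circ> v = id"
proof -
  obtain n where n: "n > 0" "w ^^ n = id"
    using finite_order[OF assms] .
  then have "w ^^ (n - 1) \<circ> w = id" "w \<circ> w ^^ (n - 1) = id"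
    by (metis Suc_diff_1 funpow_Suc_right, metis Suc_diff_1 funpow.simps(2))
  then show thesis
    using that power_in_W[OF assms] by blast
qed

lemma mult_in_group_algebra:
  assumes "x \<in> group_algebra W" "y \<in> group_algebra W"
  shows "x \<star> y \<in> group_algebra W"
  unfolding ga_mult_def
  by (intro ga.subspace_sum[OF group_algebra_subspace])
    (use assms comp_in_W in \<open>auto simp: group_algebra_def\<close>)

lemma power_in_group_algebra: "x \<in> group_algebra W \<Longrightarrow> ga_power x n \<in> group_algebra W"
  by (induction n) (auto simp: id_in_W mult_in_group_algebra)

lemma group_algebra_bound:
  fixes B :: "(('a \<Rightarrow> 'a) \<Rightarrow>\<^sub>0 'k::field) set"
  assumes "B \<subseteq> group_algebra W" "ga.independent B"
  shows "finite B" "card B \<le> card W"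
proof -
  have "finite B \<and> card B \<le> card (gelem ` W :: (('a \<Rightarrow> 'a) \<Rightarrow>\<^sub>0 'k) set)"
    using assms finite_W by (intro ga.independent_span_bound) (auto simp: group_algebra_eq_span)
  then show "finite B" "card B \<le> card W"
    using card_image_le[OF finite_W] order_trans by blast+
qed

lemma left_stable_group_algebra:
  assumes "ga.subspace N" "\<And>w x. w \<in> W \<Longrightarrow> x \<in> N \<Longrightarrow> gelem w \<star> x \<in> N"
    and "a \<in> group_algebra W" "x \<in> N"
  shows "a \<star> x \<in> N"
proof -
  have "a \<in> ga.span (gelem ` W)"
    using assms(3) by (simp add: group_algebra_eq_span)
  then show ?thesis
  proof (induction rule: ga.span_induct)
    case base
    show ?case
      using assms(1) by (auto intro!: ga.subspaceI
          simp: ga_mult_zero ga_mult_add_left ga_mult_scale_left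
            ga.subspace_0 ga.subspace_add ga.subspace_scale)
  next
    case (step y)
    then show ?case using assms by auto
  qed
qed

text \<open>Maschke's theorem for the regular representation: average a linear projection onto \<open>N\<close> over \<open>W\<close>.\<close>

theorem maschke:
  fixes N :: "(('a \<Rightarrow> 'a) \<Rightarrow>\<^sub>0 'k::field_char_0) set"
  assumes N: "ga.subspace N" "N \<subseteq> group_algebra W"
    and stable: "\<And>w x. w \<in> W \<Longrightarrow> x \<in> N \<Longrightarrow> gelem w \<star> x \<in> N"
  obtains N' where "ga.subspace N'" "N' \<subseteq> group_algebra W"
    "\<And>w x. w \<in> W \<Longrightarrow> x \<in> N' \<Longrightarrow> gelem w \<star> x \<in> N'"
    "N \<inter> N' = {0}"
    "\<And>x. x \<in> group_algebra W \<Longrightarrow> \<exists>y\<in>N. \<exists>z\<in>N'. x = y + z"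
proof -
  interpret vector_space_pair "ga_scale :: 'k \<Rightarrow> (('a \<Rightarrow> 'a) \<Rightarrow>\<^sub>0 'k) \<Rightarrow> _" "ga_scale :: 'k \<Rightarrow> (('a \<Rightarrow> 'a) \<Rightarrow>\<^sub>0 'k) \<Rightarrow> _"
    by unfold_locales
  have "\<exists>q. q ` UNIV \<subseteq> N \<and> Vector_Spaces.linear ga_scale ga_scale q \<and> (\<forall>v\<in>N. q (id v) = v)"
    using N(1) by (intro linear_exists_left_inverse_on) (auto simp: ga.linear_id ga.linear_ident)
  then obtain q :: "(('a \<Rightarrow> 'a) \<Rightarrow>\<^sub>0 'k) \<Rightarrow> _" where q: "\<And>x. q x \<in> N"
    "Vector_Spaces.linear ga_scale ga_scale q" "\<And>x. x \<in> N \<Longrightarrow> q x = x"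
    by auto
  define n :: 'k where "n = of_nat (card W)"
  have n: "n \<noteq> 0"
    using finite_W id_in_W by (auto simp: n_def)
  define i where "i w = (SOME v. v \<in> W \<and> v \<circ> w = id \<and> w \<circ> v = id)" for w :: "'a \<Rightarrow> 'a"
  have i: "i w \<in> W" "i w \<circ> w = id" "w \<circ> i w = id" if "w \<in> W" for w
    using someI_ex[of "\<lambda>v. v \<in> W \<and> v \<circ> w = id \<and> w \<circ> v = id"] inverse_in_W[OF that]
    unfolding i_def by blast+
  define p where "p x = (\<Sum>w\<in>W. gelem (i w) \<star> q (gelem w \<star> x))" for x
  have q_add: "q (x + y) = q x + q y" and q_scale: "q (ga_scale c x) = ga_scale c (q x)" for x y c
    using q(2) by (simp_all add: Vector_Spaces.linear_iff)
  have p_add: "p (x + y) = p x + p y" for x y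
    by (simp add: p_def q_add ga_mult_add_right sum.distrib)
  have p_scale: "p (ga_scale c x) = ga_scale c (p x)" for c x
    by (simp add: p_def q_scale ga_mult_scale_right ga_scale_sum)
  have p_N: "p x \<in> N" for x
    unfolding p_def by (intro ga.subspace_sum[OF N(1)] stable i q)
  have p_id: "p x = ga_scale n x" if "x \<in> N" for x
  proof -
    have "p x = (\<Sum>w\<in>W. x)"
      unfolding p_def
      by (intro sum.cong refl)
        (simp add: q stable that i gelem_mult flip: ga_mult_assoc)
    also have "\<dots> = ga_scale n x"
      by (rule poly_mapping_eqI) (simp add: lookup_sum lookup_ga_scale n_def)
    finally show ?thesis .
  qed
  have p_equiv: "p (gelem u \<star> x) = gelem u \<star> p x" if u: "u \<in> W" for u x
  proof -
    have inj: "inj_on (\<lambda>w. w \<circ> u) W"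
      using i(3)[OF u] by (intro inj_on_inverseI[of _ "\<lambda>w. w \<circ> i u"]) (simp add: comp_assoc)
    then have img: "(\<lambda>w. w \<circ> u) ` W = W"
      using endo_inj_surj[OF finite_W _ inj] u comp_in_W by blast
    have iu: "i (w \<circ> u) = i u \<circ> i w" if "w \<in> W" for w
    proof -
      have "i (w \<circ> u) = i (w \<circ> u) \<circ> (w \<circ> (u \<circ> i u) \<circ> i w)"
        using that u i by simp
      also have "\<dots> = (i (w \<circ> u) \<circ> (w \<circ> u)) \<circ> (i u \<circ> i w)"
        by (simp only: comp_assoc)
      finally show ?thesis
        using that u comp_in_W i by simp
    qed
    have "gelem u \<star> p x = (\<Sum>w\<in>W. gelem u \<star> (gelem (i (w \<circ> u)) \<star> q (gelem (w \<circ> u) \<star> x)))"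
      unfolding p_def ga_mult_sum_right
      by (subst img[symmetric], subst sum.reindex[OF inj]) simp
    also have "\<dots> = p (gelem u \<star> x)"
      unfolding p_def
    proof (intro sum.cong refl)
      fix w assume w: "w \<in> W"
      have "gelem u \<star> gelem (i (w \<circ> u)) = (gelem (i w) :: ('a \<Rightarrow> 'a) \<Rightarrow>\<^sub>0 'k)"
        using i(3)[OF u] by (simp add: iu w gelem_mult flip: comp_assoc)
      then show "gelem u \<star> (gelem (i (w \<circ> u)) \<star> q (gelem (w \<circ> u) \<star> x))
          = gelem (i w) \<star> q (gelem w \<star> (gelem u \<star> x))"
        by (simp add: gelem_mult flip: ga_mult_assoc)
    qed
    finally show ?thesis by simp
  qed
  define N' where "N' = {x \<in> group_algebra W. p x = 0}"
  have A: "ga.subspace (group_algebra W :: (('a \<Rightarrow> 'a) \<Rightarrow>\<^sub>0 'k) set)"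
    by (rule group_algebra_subspace)
  show thesis
  proof
    show "ga.subspace N'"
      using A p_scale[of 0 0] unfolding N'_def
      by (intro ga.subspaceI)
        (auto simp: p_add p_scale ga.subspace_0 ga.subspace_add ga.subspace_scale)
    show "N' \<subseteq> group_algebra W"
      by (auto simp: N'_def)
    show "gelem w \<star> x \<in> N'" if "w \<in> W" "x \<in> N'" for w x
      using that by (auto simp: N'_def p_equiv ga_mult_zero intro: mult_in_group_algebra)
    show "N \<inter> N' = {0}"
      using N A p_id n p_scale[of 0 0] by (auto simp: N'_def ga.subspace_0)
    show "\<exists>y\<in>N. \<exists>z\<in>N'. x = y + z" if x: "x \<in> group_algebra W" for x
    proof (intro bexI)
      let ?y = "ga_scale (1 / n) (p x)"
      show y: "?y \<in> N"
        using N p_N by (auto intro: ga.subspace_scale)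
      have "p (x - ?y) + p ?y = p x"
        by (simp flip: p_add)
      moreover have "p ?y = p x"
        using p_id[OF y] n by simp
      ultimately show "x - ?y \<in> N'"
        using x y N A by (auto simp: N'_def intro: ga.subspace_diff)
    qed simp
  qed
qed

end

section \<open>Solvable ideals and central ideals\<close>

context lie_algebra
begin

lemma bracket_zero [simp]: "bracket x 0 = 0" "bracket 0 x = 0"
  using bracket_scale_right[of x 0 0] bracket_scale_left[of 0 0 x] by simp_all

lemma bracket_antisym: "bracket x y = - bracket y x"
proof -
  have "bracket (x + y) (x + y) = bracket x y + bracket y x"
    unfolding bracket_add_left bracket_add_right by (simp add: bracket_self)
  then show ?thesis
    by (simp add: bracket_self eq_neg_iff_add_eq_0)
qed

lemma bracket_minus_right: "bracket x (- y) = - bracket x y"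
  using bracket_scale_right[of x "- 1" y] by simp

text \<open>The Jacobi identity, in the form that says that \<open>bracket x\<close> is a derivation.\<close>

lemma bracket_derivation:
  "bracket x (bracket y z) = bracket (bracket x y) z + bracket y (bracket x z)"
proof -
  have "bracket x (bracket y z) = - (bracket y (bracket z x) + bracket z (bracket x y))"
    using jacobi[of x y z] by (simp only: eq_neg_iff_add_eq_0 add.assoc)
  also have "bracket y (bracket z x) = - bracket y (bracket x z)"
    by (subst bracket_antisym[of z x]) (rule bracket_minus_right)
  also have "bracket z (bracket x y) = - bracket (bracket x y) z"
    by (rule bracket_antisym)
  finally show ?thesis by simp
qed

lemma subspace_bracket: "subspace S \<Longrightarrow> subspace {y. bracket x y \<in> S}"
  by (rule subspaceI)
    (simp_all add: bracket_add_right bracket_scale_right subspace_0 subspace_add subspace_scale)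

lemma lie_ideal_derived:
  assumes "lie_ideal I L"
  shows "lie_ideal (derived I) L"
  unfolding lie_ideal_def
proof (intro conjI ballI)
  let ?C = "{bracket x y | x y. x \<in> I \<and> y \<in> I}"
  show "subspace (derived I)"
    by (simp add: derived_def)
  show "derived I \<subseteq> L"
    unfolding derived_def using assms
    by (intro order_trans[OF span_minimal[of _ I]]) (auto simp: lie_ideal_def)
  fix x y assume x: "x \<in> L" and "y \<in> derived I"
  then have "y \<in> span ?C"
    by (simp add: derived_def)
  then have "bracket x y \<in> span ?C"
  proof (induction rule: span_induct)
    case base
    show ?case by (intro subspace_bracket subspace_span)
  next
    case (step y)
    then obtain u v where uv: "y = bracket u v" "u \<in> I" "v \<in> I" by blast
    have "bracket (bracket x u) v \<in> span ?C" "bracket u (bracket x v) \<in> span ?C"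
      using assms x uv unfolding lie_ideal_def by (blast intro: span_base)+
    then show ?case
      by (simp add: uv(1) bracket_derivation[of x u v] span_add)
  qed
  then show "bracket x y \<in> derived I"
    by (simp add: derived_def)
qed

lemma lie_ideal_derived_series: "lie_ideal I L \<Longrightarrow> lie_ideal ((derived ^^ n) I) L"
  by (induction n) (auto intro: lie_ideal_derived)

lemma derived_eq_0_iff: "derived I = {0} \<longleftrightarrow> (\<forall>x\<in>I. \<forall>y\<in>I. bracket x y = 0)"
proof
  assume zero: "derived I = {0}"
  have "bracket x y \<in> derived I" if "x \<in> I" "y \<in> I" for x y
    unfolding derived_def using that by (intro span_base) blast
  then show "\<forall>x\<in>I. \<forall>y\<in>I. bracket x y = 0"
    by (simp add: zero)
next
  assume "\<forall>x\<in>I. \<forall>y\<in>I. bracket x y = 0"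
  then have "derived I \<subseteq> {0}"
    unfolding derived_def by (intro span_minimal) (auto)
  then show "derived I = {0}"
    by (auto simp: derived_def span_zero)
qed

text \<open>The centre is itself an abelian ideal, so it always lies in the radical.\<close>

lemma reductiveI:
  assumes L: "lie_subalgebra L"
    and central: "\<And>I. lie_ideal I L \<Longrightarrow> lie_solvable I \<Longrightarrow> I \<subseteq> center L"
  shows "reductive L"
proof -
  have sub: "subspace (center L)"
    using L by (intro subspaceI)
      (auto simp: center_def lie_subalgebra_def bracket_add_left bracket_scale_left
        subspace_0 subspace_add subspace_scale)
  have "lie_ideal (center L) L"
    unfolding lie_ideal_def
  proof (intro conjI ballI sub)
    fix x y assume "x \<in> L" "y \<in> center L"
    then have "bracket x y = 0"
      using bracket_antisym[of x y] by (auto simp: center_def)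
    then show "bracket x y \<in> center L"
      using sub by (simp add: subspace_0)
  qed (auto simp: center_def)
  moreover have "lie_solvable (center L)"
    unfolding lie_solvable_def
    by (rule exI[of _ 1]) (auto simp: derived_eq_0_iff center_def)
  ultimately have "center L \<subseteq> radical L"
    unfolding radical_def by (intro subsetI span_base) blast
  moreover have "radical L \<subseteq> center L"
    unfolding radical_def using central sub by (intro span_minimal) auto
  ultimately show ?thesis
    using L by (auto simp: reductive_def)
qed

lemma lie_generated_subalgebra:
  assumes "lie_subalgebra A" "S \<subseteq> A"
  shows "lie_subalgebra (lie_generated A S)" "S \<subseteq> lie_generated A S" "lie_generated A S \<subseteq> A"
  using assms unfolding lie_generated_def lie_subalgebra_def
  by (auto intro!: subspace_Inter)

lemma lie_generated_minimal:
  "lie_subalgebra L \<Longrightarrow> L \<subseteq> A \<Longrightarrow> S \<subseteq> L \<Longrightarrow> lie_generated A S \<subseteq> L"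
  unfolding lie_generated_def by blast

end

section \<open>Lie subalgebras that generate the group algebra are reductive\<close>

lemma ga_bracket_leibniz:
  "ga_bracket a (x \<star> y) = ga_bracket a x \<star> y + x \<star> ga_bracket a y"
  by (simp add: ga_bracket_def ga_mult_diff_left ga_mult_diff_right ga_mult_assoc)

lemma ga_bracket_power:
  assumes "b \<star> ga_bracket a b = ga_bracket a b \<star> b"
  shows "ga_bracket a (ga_power b n)
    = ga_scale (of_nat n) (ga_power b (n - 1) \<star> ga_bracket a b)"
proof (induction n)
  case 0
  then show ?case by (simp add: ga_bracket_def)
next
  case (Suc n)
  let ?z = "ga_bracket a b"
  have z: "?z \<star> ga_power b n = ga_power b n \<star> ?z"
    using ga_power_commute[of b ?z n] assms by simp
  have "b \<star> ga_scale (of_nat n) (ga_power b (n - 1) \<star> ?z) = ga_scale (of_nat n) (ga_power b n \<star> ?z)"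
    by (cases n) (simp_all add: ga_mult_scale_right ga_mult_assoc ga_mult_zero)
  then show ?case
    using Suc by (simp add: ga_bracket_leibniz z ga.scale_left_distrib)
qed

lemma ga_bracket_sum_right: "ga_bracket a (sum h A) = (\<Sum>i\<in>A. ga_bracket a (h i))"
  by (simp add: ga_bracket_def ga_mult_sum_left ga_mult_sum_right sum_subtractf)

text \<open>If \<open>p(b) z^m = 0\<close>, then \<open>p'(b) z^(m+2) = 0\<close>. Apply the derivation \<open>ga_bracket a\<close>, which sends \<open>p(b)\<close> to
\<open>p'(b) z\<close>, and multiply by \<open>z\<close> on the right: the part that comes from differentiating \<open>z^m\<close> is then
a multiple of \<open>p(b) z^m [a, z] = 0\<close>.\<close>

lemma relation_derivative:
  fixes a b :: "('a \<Rightarrow> 'a) \<Rightarrow>\<^sub>0 'k::field_char_0"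
  defines "z \<equiv> ga_bracket a b"
  assumes bz: "b \<star> z = z \<star> b" and zz: "z \<star> ga_bracket a z = ga_bracket a z \<star> z"
    and rel: "(\<Sum>i\<le>Suc d. ga_scale (c i) (ga_power b i)) \<star> ga_power z m = 0"
  shows "(\<Sum>i\<le>d. ga_scale (of_nat (Suc i) * c (Suc i)) (ga_power b i)) \<star> ga_power z (Suc (Suc m)) = 0"
proof -
  let ?P = "\<Sum>i\<le>Suc d. ga_scale (c i) (ga_power b i)"
  let ?P' = "\<Sum>i\<le>d. ga_scale (of_nat (Suc i) * c (Suc i)) (ga_power b i)"
  have "ga_bracket a ?P = (\<Sum>i\<le>Suc d. ga_scale (c i * of_nat i) (ga_power b (i - 1) \<star> z))"
    using ga_bracket_power[of b a] bz
    by (simp add: ga_bracket_sum_right ga.bracket_scale_right flip: z_def del: sum.atMost_Suc)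
  also have "\<dots> = ?P' \<star> z"
    by (subst sum.atMost_Suc_shift)
      (simp add: ga_mult_sum_left ga_mult_scale_left mult.commute)
  finally have P: "ga_bracket a ?P = ?P' \<star> z" .
  have "0 = ga_bracket a (?P \<star> ga_power z m) \<star> z"
    using rel by (simp add: ga_bracket_def ga_mult_zero)
  also have "\<dots> = ?P' \<star> ga_power z (Suc (Suc m)) + ?P \<star> ga_bracket a (ga_power z m) \<star> z"
    unfolding ga_bracket_leibniz P ga_mult_add_left
    using ga_power_commute[of z z m] by (simp add: ga_mult_assoc del: sum.atMost_Suc)
  also have "?P \<star> ga_bracket a (ga_power z m) \<star> z = 0"
  proof (cases m)
    case 0
    then show ?thesis by (simp add: ga_bracket_def ga_mult_zero)
  next
    case (Suc k)
    have "ga_bracket a (ga_power z m) \<star> z = ga_scale (of_nat m) (ga_power z k \<star> z \<star> ga_bracket a z)"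
      unfolding ga_bracket_power[OF zz] ga_mult_scale_left ga_mult_assoc zz Suc by simp
    also have "ga_power z k \<star> z = ga_power z m"
      using ga_power_commute[of z z k] Suc by simp
    finally have "?P \<star> ga_bracket a (ga_power z m) \<star> z
        = ga_scale (of_nat m) (?P \<star> ga_power z m \<star> ga_bracket a z)"
      by (simp add: ga_mult_assoc ga_mult_scale_right del: sum.atMost_Suc)
    then show ?thesis
      using rel by (simp add: ga_mult_zero)
  qed
  finally show ?thesis by simp
qed

context finite_permutation_group
begin

text \<open>The powers of an element are linearly dependent because the group algebra has finite dimension.\<close>

lemma power_relation:
  fixes b :: "('a \<Rightarrow> 'a) \<Rightarrow>\<^sub>0 'k::field"
  assumes b: "b \<in> group_algebra W"
  obtains d c where "c d \<noteq> 0" "(\<Sum>i\<le>d. ga_scale (c i) (ga_power b i)) = 0"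
proof -
  have "\<exists>d. ga_power b d \<in> ga.span (ga_power b ` {..<d})"
  proof (rule ccontr)
    assume "\<not> ?thesis"
    then have neg: "ga_power b n \<notin> ga.span (ga_power b ` {..<n})" for n
      by (simp only: not_ex not_False_eq_True)
    have "ga.independent (ga_power b ` {..<n}) \<and> card (ga_power b ` {..<n}) = n" for n
    proof (induction n)
      case (Suc n)
      have "ga_power b n \<notin> ga_power b ` {..<n}"
        using neg[of n] ga.span_superset by (rule contra_subsetD[rotated])
      with Suc neg show ?case
        by (simp add: lessThan_Suc ga.independent_insert)
    qed (simp add: ga.independent_empty)
    from this[of "Suc (card W)"] group_algebra_bound(2)[of "ga_power b ` {..<Suc (card W)}"]
    show False
      using power_in_group_algebra[OF b] by (auto simp del: ga_power.simps)
  qed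
  then obtain d where d: "ga_power b d \<in> ga.span (ga_power b ` {..<d})" by blast
  have "\<exists>c. x = (\<Sum>i<d. ga_scale (c i) (ga_power b i))" if "x \<in> ga.span (ga_power b ` {..<d})" for x
    using that
  proof (induction rule: ga.span_induct_alt)
    case base
    show ?case by (rule exI[of _ "\<lambda>_. 0"]) simp
  next
    case (step e x y)
    then obtain j c where "j < d" "x = ga_power b j" "y = (\<Sum>i<d. ga_scale (c i) (ga_power b i))"
      by blast
    moreover have "ga_scale e (ga_power b j) = (\<Sum>i<d. ga_scale (if i = j then e else 0) (ga_power b i))"
      using \<open>j < d\<close> by (simp add: if_distrib[of "\<lambda>c. ga_scale c _"] sum.delta cong: if_cong)
    ultimately show ?case
      by (intro exI[of _ "\<lambda>i. (if i = j then e else 0) + c i"])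
        (simp only: ga.scale_left_distrib sum.distrib)
  qed
  with d obtain c where c: "ga_power b d = (\<Sum>i<d. ga_scale (c i) (ga_power b i))" by blast
  show thesis
  proof (rule that[of "\<lambda>i. if i < d then - c i else 1" d])
    show "(\<Sum>i\<le>d. ga_scale (if i < d then - c i else 1) (ga_power b i)) = 0"
      by (simp add: lessThan_Suc_atMost[symmetric] c sum_negf)
  qed simp
qed

text \<open>A version of Jacobson's lemma that works over any field of characteristic 0: differentiate a
polynomial relation for \<open>b\<close> until its degree is 0. Each differentiation multiplies the leading
coefficient by the degree, so it stays nonzero, and what is left says that a power of \<open>z\<close> is zero.\<close>

lemma nilpotent_commutator:
  fixes a b :: "('a \<Rightarrow> 'a) \<Rightarrow>\<^sub>0 'k::field_char_0"
  defines "z \<equiv> ga_bracket a b"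
  assumes b: "b \<in> group_algebra W"
    and bz: "b \<star> z = z \<star> b" and zz: "z \<star> ga_bracket a z = ga_bracket a z \<star> z"
  shows "\<exists>m. ga_power z m = 0"
proof -
  have "\<exists>m. ga_power z m = 0" if "c d \<noteq> 0"
    "(\<Sum>i\<le>d. ga_scale (c i) (ga_power b i)) \<star> ga_power z m = 0" for c d m
    using that
  proof (induction d arbitrary: c m)
    case 0
    then have "ga_scale (c 0) (ga_power z m) = 0"
      by (simp add: ga_mult_scale_left)
    then show ?case using 0 by auto
  next
    case (Suc d)
    show ?case
      using Suc.prems(1) relation_derivative[OF bz[unfolded z_def] zz[unfolded z_def] Suc.prems(2)[unfolded z_def]]
      by (intro Suc.IH[of "\<lambda>i. of_nat (Suc i) * c (Suc i)" "Suc (Suc m)"])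
        (simp_all only: z_def mult_eq_0_iff of_nat_eq_0_iff, simp)
  qed
  moreover obtain d c where "c d \<noteq> 0" "(\<Sum>i\<le>d. ga_scale (c i) (ga_power b i)) = 0"
    using power_relation[OF b] .
  ultimately show ?thesis
    by (metis ga_mult_zero(1))
qed

text \<open>Induction on \<open>Z\<close>: a vector killed by the earlier elements stays so under powers of the next one, and
the last nonzero vector of the form \<open>y^i x\<close> is killed by \<open>y\<close> as well.\<close>

lemma common_kernel:
  assumes "finite Z"
    and "\<And>y z. y \<in> Z \<Longrightarrow> z \<in> Z \<Longrightarrow> y \<star> z = z \<star> y"
    and "\<And>z. z \<in> Z \<Longrightarrow> \<exists>m. ga_power z m = 0"
    and "\<And>z x. z \<in> Z \<Longrightarrow> x \<in> N \<Longrightarrow> z \<star> x \<in> N"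
    and "x\<^sub>0 \<in> N" "x\<^sub>0 \<noteq> 0"
  shows "\<exists>x\<in>N. x \<noteq> 0 \<and> (\<forall>z\<in>Z. z \<star> x = 0)"
  using assms(1-4)
proof (induction Z rule: finite_induct)
  case empty
  then show ?case using assms(5,6) by auto
next
  case (insert y Z)
  then obtain x where x: "x \<in> N" "x \<noteq> 0" "\<forall>z\<in>Z. z \<star> x = 0"
    by auto
  obtain m where m: "ga_power y m = 0" using insert.prems by blast
  define j where "j = (LEAST j. ga_power y j \<star> x = 0)"
  have j: "ga_power y j \<star> x = 0"
    unfolding j_def by (rule LeastI[of _ m]) (simp add: m ga_mult_zero)
  then obtain i where i: "j = Suc i"
    using x(2) by (cases j) auto
  let ?x = "ga_power y i \<star> x"
  have "?x \<noteq> 0"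
    using not_less_Least[of i "\<lambda>j. ga_power y j \<star> x = 0"] i j_def by simp
  moreover have "ga_power y n \<star> x \<in> N" for n
    using insert.prems x by (induction n) (auto simp: ga_mult_assoc)
  moreover have "y \<star> ?x = 0"
    using j i by (simp add: ga_mult_assoc)
  moreover have "z \<star> ?x = 0" if z: "z \<in> Z" for z
  proof -
    have "z \<star> ga_power y i = ga_power y i \<star> z"
      using insert.prems(1)[of y z] z by (intro ga_power_commute[symmetric]) simp
    then have "z \<star> ?x = ga_power y i \<star> (z \<star> x)"
      by (simp flip: ga_mult_assoc)
    then show ?thesis
      using x(3) z by (simp add: ga_mult_zero)
  qed
  ultimately show ?case by blast
qed

end

text \<open>The submonoid generated by \<open>X\<close>. In a finite group it is the subgroup generated by \<open>X\<close>, and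
induction on it needs no case for inverses.\<close>

inductive_set words :: "('a \<Rightarrow> 'a) set \<Rightarrow> ('a \<Rightarrow> 'a) set" for X where
  words_id: "id \<in> words X"
| words_comp: "u \<in> X \<Longrightarrow> w \<in> words X \<Longrightarrow> u \<circ> w \<in> words X"

lemma words_incl: "u \<in> X \<Longrightarrow> u \<in> words X"
  using words_comp[OF _ words_id, of u X] by simp

lemma words_closed: "v \<in> words X \<Longrightarrow> w \<in> words X \<Longrightarrow> v \<circ> w \<in> words X"
  by (induction rule: words.induct) (auto simp: comp_assoc words_comp)

lemma words_power: "u \<in> X \<Longrightarrow> u ^^ n \<in> words X"
  by (induction n) (auto intro: words_id words_comp)

lemma words_mono: "X \<subseteq> Y \<Longrightarrow> words X \<subseteq> words Y"
proof
  fix w assume "X \<subseteq> Y" "w \<in> words X"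
  show "w \<in> words Y"
    using \<open>w \<in> words X\<close>
    by induction (use \<open>X \<subseteq> Y\<close> in \<open>blast intro: words_id words_comp\<close>)+
qed

locale generated_permutation_group = finite_permutation_group W
  for W :: "('a \<Rightarrow> 'a) set" +
  fixes X :: "('a \<Rightarrow> 'a) set"
  assumes generators_in_W: "X \<subseteq> W"
    and words_generators: "W \<subseteq> words X"
begin

text \<open>Combined with \<open>left_stable_group_algebra\<close>, this reduces the left ideal property to the generators.\<close>

lemma stable_under_words:
  assumes "\<And>u x. u \<in> X \<Longrightarrow> x \<in> N \<Longrightarrow> gelem u \<star> x \<in> N" and "w \<in> W" "x \<in> N"
  shows "gelem w \<star> x \<in> N"
proof -
  have "w \<in> words X" using assms(2) words_generators by blast
  then show ?thesis
  proof induction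
    case words_id
    show ?case using assms(3) ga_mult_id_left[of x] by (simp add: id_def)
  next
    case (words_comp u v)
    then show ?case
      using assms(1)[of u "gelem v \<star> x"] by (simp only: ga_mult_assoc flip: gelem_mult)
  qed
qed

text \<open>The common kernel \<open>N\<close> of \<open>Z\<close> is stable under left multiplication by each generator \<open>u\<close>, since
\<open>z u x = u z x - [u, z] x\<close> and \<open>[u, z]\<close> lies in the span of \<open>Z\<close>. An invariant complement of \<open>N\<close> has no
nonzero vector killed by \<open>Z\<close>, hence is zero by \<open>common_kernel\<close>. So \<open>N\<close> contains the unit element.\<close>

lemma commuting_nilpotent_ideal_trivial:
  fixes L Z :: "(('a \<Rightarrow> 'a) \<Rightarrow>\<^sub>0 'k::field_char_0) set"
  assumes X: "gelem ` X \<subseteq> L"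
    and Z: "Z \<subseteq> group_algebra W"
    and comm: "\<And>y z. y \<in> Z \<Longrightarrow> z \<in> Z \<Longrightarrow> y \<star> z = z \<star> y"
    and nilp: "\<And>z. z \<in> Z \<Longrightarrow> \<exists>m. ga_power z m = 0"
    and ideal: "\<And>l z. l \<in> L \<Longrightarrow> z \<in> Z \<Longrightarrow> ga_bracket l z \<in> ga.span Z"
  shows "Z \<subseteq> {0}"
proof -
  let ?A = "group_algebra W :: (('a \<Rightarrow> 'a) \<Rightarrow>\<^sub>0 'k) set"
  define N where "N = {x \<in> ?A. \<forall>z\<in>Z. z \<star> x = 0}"
  have span_kills: "t \<star> x = 0" if "t \<in> ga.span B" "\<forall>z\<in>B. z \<star> x = 0"
    for t x :: "('a \<Rightarrow> 'a) \<Rightarrow>\<^sub>0 'k" and B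
    using that(1)
  proof (induction rule: ga.span_induct)
    case base
    show ?case
      by (rule ga.subspaceI) (simp_all add: ga_mult_zero ga_mult_add_left ga_mult_scale_left)
  qed (use that(2) in blast)
  have A: "ga.subspace ?A"
    by (rule group_algebra_subspace)
  have N_subspace: "ga.subspace N"
    unfolding N_def using A
    by (intro ga.subspaceI)
      (auto simp: ga_mult_zero ga_mult_add_right ga_mult_scale_right
        ga.subspace_0 ga.subspace_add ga.subspace_scale)
  have "gelem u \<star> x \<in> N" if u: "u \<in> X" and x: "x \<in> N" for u x
  proof -
    have "z \<star> (gelem u \<star> x) = 0" if z: "z \<in> Z" for z
    proof -
      have "ga_bracket (gelem u) z \<star> x = 0"
        using ideal[of "gelem u" z] u z X x by (intro span_kills[of _ Z]) (auto simp: N_def)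
      then show ?thesis
        using x z by (simp add: ga_bracket_def ga_mult_diff_left N_def ga_mult_assoc ga_mult_zero)
    qed
    then show ?thesis
      using u x generators_in_W by (auto simp: N_def intro!: mult_in_group_algebra)
  qed
  then have N_stable: "gelem w \<star> x \<in> N" if "w \<in> W" "x \<in> N" for w x
    using stable_under_words that by blast
  obtain N' where N': "ga.subspace N'" "N' \<subseteq> ?A"
    "\<And>w x. w \<in> W \<Longrightarrow> x \<in> N' \<Longrightarrow> gelem w \<star> x \<in> N'" "N \<inter> N' = {0}"
    "\<And>x. x \<in> ?A \<Longrightarrow> \<exists>y\<in>N. \<exists>z\<in>N'. x = y + z"
    using maschke[OF N_subspace _ N_stable] by (auto simp: N_def)
  have "N' \<subseteq> {0}"
  proof
    fix x assume x: "x \<in> N'"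
    \<comment> \<open>\<open>Z\<close> may be infinite, while \<open>common_kernel\<close> is about finite sets; a basis of its span is enough.\<close>
    obtain B where B: "B \<subseteq> Z" "ga.independent B" "Z \<subseteq> ga.span B"
      using ga.maximal_independent_subset[of Z] .
    show "x \<in> {0}"
    proof (rule ccontr)
      assume "x \<notin> {0}"
      then obtain y where y: "y \<in> N'" "y \<noteq> 0" "\<forall>z\<in>B. z \<star> y = 0"
        using common_kernel[of B N' x] group_algebra_bound(1)[of B] B x Z comm nilp
          left_stable_group_algebra[OF N'(1,3)]
        by (smt (verit) singletonI subset_iff)
      then have "y \<in> N"
        using B(3) N'(2) span_kills[of _ B y] by (auto simp: N_def)
      then show False using y N'(4) by blast
    qed
  qed
  then have "?A \<subseteq> N"
    using N'(5) by fastforce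
  then have "gelem id \<in> N"
    using id_in_W gelem_in_group_algebra[of id W] by blast
  then show ?thesis
    by (auto simp: N_def)
qed

end

context generated_permutation_group
begin

context
  fixes L :: "(('a \<Rightarrow> 'a) \<Rightarrow>\<^sub>0 'k::field_char_0) set"
  assumes L: "ga.lie_subalgebra L" "L \<subseteq> group_algebra W" "gelem ` X \<subseteq> L"
begin

lemma abelian_ideal_central:
  assumes I: "ga.lie_ideal I L" and abelian: "\<And>x y. x \<in> I \<Longrightarrow> y \<in> I \<Longrightarrow> ga_bracket x y = 0"
  shows "I \<subseteq> ga.center L"
proof -
  let ?Z = "{ga_bracket a b | a b. a \<in> L \<and> b \<in> I}"
  have Z_I: "?Z \<subseteq> I"
    using I by (auto simp: ga.lie_ideal_def)
  have I_A: "I \<subseteq> group_algebra W"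
    using I L by (auto simp: ga.lie_ideal_def)
  have comm: "x \<star> y = y \<star> x" if "x \<in> I" "y \<in> I" for x y
    using abelian[OF that] by (simp add: ga_bracket_eq_0_iff)
  have "?Z \<subseteq> {0}"
  proof (rule commuting_nilpotent_ideal_trivial[OF L(3)])
    show "?Z \<subseteq> group_algebra W"
      using Z_I I_A by blast
    show "y \<star> z = z \<star> y" if "y \<in> ?Z" "z \<in> ?Z" for y z
      using subsetD[OF Z_I that(1)] subsetD[OF Z_I that(2)] by (rule comm)
    show "\<exists>m. ga_power z m = 0" if "z \<in> ?Z" for z
    proof -
      from that obtain a b where z: "z = ga_bracket a b" "a \<in> L" "b \<in> I" by blast
      have "ga_bracket a z \<in> I" "z \<in> I"
        using I z that Z_I by (auto simp: ga.lie_ideal_def)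
      then show ?thesis
        unfolding z(1) using z I_A comm by (intro nilpotent_commutator) auto
    qed
    show "ga_bracket l z \<in> ga.span ?Z" if "l \<in> L" "z \<in> ?Z" for l z
      using that Z_I by (intro ga.span_base) blast
  qed
  then have "ga_bracket a b = 0" if "a \<in> L" "b \<in> I" for a b
    using that by blast
  then show ?thesis
    using I by (auto simp: ga.center_def ga.lie_ideal_def ga_bracket_eq_0_iff)
qed

text \<open>A central commutator \<open>z = [a, b]\<close> commutes with \<open>b\<close> and satisfies \<open>[a, z] = 0\<close>, so it is nilpotent.\<close>

lemma central_commutators_trivial:
  assumes K: "K \<subseteq> L" and central: "\<And>x y. x \<in> K \<Longrightarrow> y \<in> K \<Longrightarrow> ga_bracket x y \<in> ga.center L"
    and xy: "x \<in> K" "y \<in> K"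
  shows "ga_bracket x y = 0"
proof -
  let ?Z = "{ga_bracket a b | a b. a \<in> K \<and> b \<in> K}"
  have Z_L: "?Z \<subseteq> L"
    using central by (auto simp: ga.center_def)
  have Z: "l \<star> z = z \<star> l" if "z \<in> ?Z" "l \<in> L" for z l
    using that central by (auto simp: ga.center_def ga_bracket_eq_0_iff)
  have Z_A: "?Z \<subseteq> group_algebra W"
    using Z_L L by simp
  have "?Z \<subseteq> {0}"
  proof (rule commuting_nilpotent_ideal_trivial[OF L(3) Z_A])
    show "y \<star> z = z \<star> y" if "y \<in> ?Z" "z \<in> ?Z" for y z
      using Z[OF that(2) subsetD[OF Z_L that(1)]] .
    show "\<exists>m. ga_power z m = 0" if "z \<in> ?Z" for z
    proof -
      from that obtain a b where z: "z = ga_bracket a b" "a \<in> K" "b \<in> K" by blast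
      have "ga_bracket a z = 0"
        using Z[OF that, of a] z K by (auto simp: ga_bracket_eq_0_iff)
      then show ?thesis
        unfolding z(1) using z K L Z[OF that, of b]
        by (intro nilpotent_commutator) (auto simp: ga_mult_zero)
    qed
    show "ga_bracket l z \<in> ga.span ?Z" if "l \<in> L" "z \<in> ?Z" for l z
      using Z[OF that(2,1)] ga.span_zero by (simp add: ga_bracket_def)
  qed
  then show ?thesis
    using xy by blast
qed

text \<open>By \<open>abelian_ideal_central\<close> the last nonzero term of the derived series of a solvable ideal is central.
If it were the derived algebra of an earlier term, it would be zero by \<open>central_commutators_trivial\<close>. So the series
stops at its first step, and the ideal is abelian.\<close>

theorem reductive_if_generates: "ga.reductive L"
proof (rule ga.reductiveI[OF L(1)])
  fix I assume I: "ga.lie_ideal I L" and "ga.lie_solvable I"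
  then obtain n where "(ga.derived ^^ n) I = {0}"
    by (auto simp: ga.lie_solvable_def)
  moreover have "ga.derived {0} = {0}"
    by (simp add: ga.derived_eq_0_iff)
  ultimately have n: "(ga.derived ^^ Suc n) I = {0}"
    by simp
  have "ga.derived I = {0}"
    using n
  proof (induction n)
    case (Suc n)
    let ?K = "(ga.derived ^^ n) I" and ?J = "(ga.derived ^^ Suc n) I"
    have "ga_bracket x y = 0" if "x \<in> ?J" "y \<in> ?J" for x y
      using Suc.prems that by (simp add: ga.derived_eq_0_iff)
    then have J: "?J \<subseteq> ga.center L"
      by (intro abelian_ideal_central ga.lie_ideal_derived_series I)
    have K: "?K \<subseteq> L"
      using ga.lie_ideal_derived_series[OF I, of n] by (simp add: ga.lie_ideal_def)
    have "ga_bracket x y \<in> ?J" if "x \<in> ?K" "y \<in> ?K" for x y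
      using that by (auto simp: ga.derived_def intro!: ga.span_base)
    then have "ga_bracket x y = 0" if "x \<in> ?K" "y \<in> ?K" for x y
      using that J by (intro central_commutators_trivial[OF K]) auto
    then have "?J = {0}"
      by (simp add: ga.derived_eq_0_iff)
    then show ?case by (rule Suc.IH)
  qed simp
  then show "I \<subseteq> ga.center L"
    by (intro abelian_ideal_central I) (simp add: ga.derived_eq_0_iff)
qed

end

end

section \<open>Conjugation by an element whose powers lie in a Lie subalgebra\<close>

text \<open>Write \<open>Q y\<close> for the sum of \<open>s^k y s^(-k)\<close> over \<open>k < e\<close>. It commutes with \<open>s\<close>, and \<open>Q\<close> is \<open>e\<close> times a
projection. Expanding double brackets and summing over \<open>k < e\<close> gives

\<^item> the sum of \<open>[s^k, [s^(-k), y]]\<close> is \<open>2 e y - 2 Q y\<close>, so \<open>Q\<close> preserves \<open>L\<close>;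

\<^item> the sum of \<open>[s^(k+1), [s^(-k), y]]\<close> is \<open>e (s y + y s)\<close> if \<open>Q y = 0\<close>. As \<open>s y - y s\<close> lies in \<open>L\<close> too,
  so do \<open>s y\<close> and \<open>y s\<close>.

Split \<open>e x\<close> as \<open>Q x\<close>, which conjugation by \<open>s\<close> fixes, plus an element \<open>y\<close> of \<open>L\<close> with \<open>Q y = 0\<close>; the second
point applies to \<open>y\<close> and to what is obtained from it by multiplying with \<open>s\<close> on either side.\<close>

lemma conjugation_by_cyclic_group:
  fixes L :: "(('a \<Rightarrow> 'a) \<Rightarrow>\<^sub>0 'k::field_char_0) set"
  assumes L: "ga.lie_subalgebra L"
    and s: "e > 0" "s ^^ e = id"
    and powers: "\<And>k. s ^^ k \<noteq> id \<Longrightarrow> gelem (s ^^ k) \<in> L"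
    and x: "x \<in> L"
  shows "gelem s \<star> x \<star> gelem (s ^^ (e - 1)) \<in> L"
proof -
  define \<sigma> :: "nat \<Rightarrow> (('a \<Rightarrow> 'a) \<Rightarrow>\<^sub>0 'k)" where "\<sigma> k = gelem (s ^^ k)" for k
  have \<sigma>_mult: "\<sigma> i \<star> \<sigma> j = \<sigma> (i + j)" for i j
    by (simp add: \<sigma>_def gelem_mult funpow_add)
  have \<sigma>_mult': "\<sigma> i \<star> (\<sigma> j \<star> y) = \<sigma> (i + j) \<star> y" for i j y
    by (simp add: \<sigma>_mult flip: ga_mult_assoc)
  have \<sigma>_0: "\<sigma> 0 = gelem id"
    by (simp add: \<sigma>_def)
  have \<sigma>_e: "\<sigma> (e + k) = \<sigma> k" for k
    by (simp add: \<sigma>_def funpow_add s)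
  have \<sigma>_e0: "\<sigma> e = gelem id"
    using \<sigma>_e[of 0] \<sigma>_0 by simp
  have sub: "ga.subspace L"
    using L by (simp add: ga.lie_subalgebra_def)
  have br: "ga_bracket (\<sigma> k) y \<in> L" if "y \<in> L" for k y
  proof (cases "s ^^ k = id")
    case True
    then show ?thesis
      using sub by (simp add: \<sigma>_def ga_bracket_def ga.subspace_0)
  next
    case False
    then show ?thesis
      using L powers[OF False] that by (simp add: \<sigma>_def ga.lie_subalgebra_def)
  qed
  have scale_L: "ga_scale c y \<in> L \<longleftrightarrow> y \<in> L" if "c \<noteq> 0" for c y
    using ga.subspace_scale[OF sub, of "ga_scale c y" "1 / c"] ga.subspace_scale[OF sub, of y c] that
    by auto
  have const_sum: "(\<Sum>k<e. y) = ga_scale (of_nat e) y" for y :: "('a \<Rightarrow> 'a) \<Rightarrow>\<^sub>0 'k"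
    by (rule poly_mapping_eqI) (simp add: lookup_sum lookup_ga_scale)
  have e: "(of_nat e :: 'k) \<noteq> 0"
    using s(1) by simp
  \<comment> \<open>Exponents are natural numbers, so \<open>\<sigma> (e - k)\<close> plays the role of the inverse of \<open>\<sigma> k\<close>.\<close>
  define Q where "Q y = (\<Sum>k<e. \<sigma> k \<star> y \<star> \<sigma> (e - k))" for y
  have Q_add: "Q (y + z) = Q y + Q z" and Q_scale: "Q (ga_scale c y) = ga_scale c (Q y)" for y z c
    by (simp_all add: Q_def ga_mult_add_left ga_mult_add_right ga_mult_scale_left
        ga_mult_scale_right sum.distrib ga_scale_sum)
  \<comment> \<open>Reversing the range \<open>0, \<dots>, e\<close> swaps the two sums, and both have the term \<open>y\<close> at \<open>k = e\<close>.\<close>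
  have Q_rev: "(\<Sum>k<e. \<sigma> (e - k) \<star> y \<star> \<sigma> k) = Q y" for y
  proof -
    have "(\<Sum>k<Suc e. \<sigma> (e - k) \<star> y \<star> \<sigma> k) = (\<Sum>k<Suc e. \<sigma> k \<star> y \<star> \<sigma> (e - k))"
      by (rule sum.reindex_bij_witness[of _ "\<lambda>k. e - k" "\<lambda>k. e - k"]) auto
    then show ?thesis
      by (simp add: Q_def \<sigma>_0 \<sigma>_e0)
  qed
  have Q_central1: "\<sigma> 1 \<star> Q y = Q y \<star> \<sigma> 1" for y
  proof -
    let ?f = "\<lambda>k. \<sigma> k \<star> y \<star> \<sigma> (e + 1 - k)"
    have "\<sigma> 1 \<star> Q y = (\<Sum>k<e. ?f (Suc k))"
      by (simp add: Q_def ga_mult_sum_right ga_mult_assoc \<sigma>_mult')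
    also have "\<dots> = (\<Sum>k<e. ?f k)"
      using sum.lessThan_Suc_shift[of ?f e] \<sigma>_e[of 1] by (simp add: \<sigma>_0 \<sigma>_e0)
    also have "\<dots> = Q y \<star> \<sigma> 1"
      by (simp add: Q_def ga_mult_sum_left ga_mult_assoc \<sigma>_mult Suc_diff_le)
    finally show ?thesis .
  qed
  have Q_central: "\<sigma> k \<star> Q y = Q y \<star> \<sigma> k" for k y
  proof (induction k)
    case (Suc k)
    have "\<sigma> (Suc k) \<star> Q y = \<sigma> 1 \<star> (\<sigma> k \<star> Q y)"
      by (simp add: \<sigma>_mult')
    also have "\<dots> = Q y \<star> \<sigma> (Suc k)"
      by (simp only: Suc.IH Q_central1 \<sigma>_mult flip: ga_mult_assoc) (simp add: \<sigma>_mult ga_mult_assoc)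
    finally show ?case .
  qed (simp add: \<sigma>_0)
  have Q_Q: "Q (Q y) = ga_scale (of_nat e) (Q y)" for y
  proof -
    have "Q (Q y) = (\<Sum>k<e. Q y)"
      unfolding Q_def[of "Q y"]
      by (intro sum.cong refl) (simp add: Q_central ga_mult_assoc \<sigma>_mult \<sigma>_e0)
    then show ?thesis by (simp add: const_sum)
  qed
  have Q_L: "Q y \<in> L" if y: "y \<in> L" for y
  proof -
    have "(\<Sum>k<e. ga_bracket (\<sigma> k) (ga_bracket (\<sigma> (e - k)) y))
      = (\<Sum>k<e. y - \<sigma> k \<star> y \<star> \<sigma> (e - k) - \<sigma> (e - k) \<star> y \<star> \<sigma> k + y)"
      by (intro sum.cong refl)
        (simp add: ga_bracket_def ga_mult_diff_left ga_mult_diff_right ga_mult_assoc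
          \<sigma>_mult \<sigma>_mult' \<sigma>_e0)
    also have "\<dots> = ga_scale (of_nat e) y + ga_scale (of_nat e) y - (Q y + Q y)"
      by (simp add: sum.distrib sum_subtractf const_sum Q_rev flip: Q_def)
    finally have "ga_scale 2 (Q y) = ga_scale (of_nat e) y + ga_scale (of_nat e) y
      - (\<Sum>k<e. ga_bracket (\<sigma> k) (ga_bracket (\<sigma> (e - k)) y))"
      using ga.scale_left_distrib[of 1 1 "Q y"] by simp
    moreover have "(\<Sum>k<e. ga_bracket (\<sigma> k) (ga_bracket (\<sigma> (e - k)) y)) \<in> L"
      by (intro ga.subspace_sum[OF sub] br y)
    ultimately have "ga_scale 2 (Q y) \<in> L"
      using y sub by (simp add: ga.subspace_add ga.subspace_diff ga.subspace_scale)
    then show ?thesis by (simp add: scale_L)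
  qed
  have one_step: "\<sigma> 1 \<star> y \<in> L" "y \<star> \<sigma> 1 \<in> L" if y: "y \<in> L" "Q y = 0" for y
  proof -
    have "(\<Sum>k<e. ga_bracket (\<sigma> (Suc k)) (ga_bracket (\<sigma> (e - k)) y))
      = (\<Sum>k<e. \<sigma> 1 \<star> y - \<sigma> 1 \<star> (\<sigma> k \<star> y \<star> \<sigma> (e - k)) - \<sigma> (e - k) \<star> y \<star> \<sigma> k \<star> \<sigma> 1 + y \<star> \<sigma> 1)"
      using \<sigma>_e[of 1]
      by (intro sum.cong refl)
        (simp add: ga_bracket_def ga_mult_diff_left ga_mult_diff_right ga_mult_assoc
          \<sigma>_mult \<sigma>_mult')
    also have "\<dots> = ga_scale (of_nat e) (\<sigma> 1 \<star> y + y \<star> \<sigma> 1)"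
      by (simp add: sum.distrib sum_subtractf const_sum ga.scale_right_distrib Q_rev y ga_mult_zero
          flip: ga_mult_sum_left ga_mult_sum_right Q_def)
        (simp add: ga_mult_scale_left ga_mult_scale_right)
    finally have eq: "ga_scale (of_nat e) (\<sigma> 1 \<star> y + y \<star> \<sigma> 1)
      = (\<Sum>k<e. ga_bracket (\<sigma> (Suc k)) (ga_bracket (\<sigma> (e - k)) y))" ..
    have "ga_scale (of_nat e) (\<sigma> 1 \<star> y + y \<star> \<sigma> 1) \<in> L"
      unfolding eq by (intro ga.subspace_sum[OF sub] br y)
    then have plus: "\<sigma> 1 \<star> y + y \<star> \<sigma> 1 \<in> L"
      using e by (simp add: scale_L)
    have minus: "\<sigma> 1 \<star> y - y \<star> \<sigma> 1 \<in> L"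
      using br[OF y(1), of 1] by (simp add: ga_bracket_def)
    have "ga_scale 2 (\<sigma> 1 \<star> y) \<in> L" "ga_scale 2 (y \<star> \<sigma> 1) \<in> L"
      using ga.subspace_add[OF sub plus minus] ga.subspace_diff[OF sub plus minus]
        ga.scale_left_distrib[of 1 1 "\<sigma> 1 \<star> y"] ga.scale_left_distrib[of 1 1 "y \<star> \<sigma> 1"]
      by simp_all
    then show "\<sigma> 1 \<star> y \<in> L" "y \<star> \<sigma> 1 \<in> L"
      by (simp_all add: scale_L)
  qed
  have Q_left: "Q (\<sigma> 1 \<star> y) = \<sigma> 1 \<star> Q y" and Q_right: "Q (y \<star> \<sigma> 1) = Q y \<star> \<sigma> 1" for y
    by (simp_all add: Q_def ga_mult_sum_left ga_mult_sum_right ga_mult_assoc \<sigma>_mult \<sigma>_mult' add.commute)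
  have right_mult: "y \<star> \<sigma> n \<in> L \<and> Q (y \<star> \<sigma> n) = 0" if y: "y \<in> L" "Q y = 0" for y n
  proof (induction n)
    case (Suc n)
    have "y \<star> \<sigma> (Suc n) = y \<star> \<sigma> n \<star> \<sigma> 1"
      by (simp add: ga_mult_assoc \<sigma>_mult)
    then show ?case
      using Suc one_step(2)[of "y \<star> \<sigma> n"] Q_right[of "y \<star> \<sigma> n"] by (simp add: ga_mult_zero)
  qed (use y in \<open>simp add: \<sigma>_0\<close>)
  define y where "y = ga_scale (of_nat e) x - Q x"
  have y: "y \<in> L" "Q y = 0"
  proof -
    show "y \<in> L"
      using x sub Q_L by (simp add: y_def ga.subspace_diff ga.subspace_scale)
    have "Q y + Q (Q x) = ga_scale (of_nat e) (Q x)"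
      by (simp add: y_def flip: Q_add Q_scale)
    then show "Q y = 0" by (simp add: Q_Q)
  qed
  have "\<sigma> 1 \<star> y \<star> \<sigma> (e - 1) \<in> L"
    using right_mult[of "\<sigma> 1 \<star> y"] one_step(1) y Q_left[of y] by (simp add: ga_mult_zero)
  moreover have "\<sigma> 1 \<star> Q x \<star> \<sigma> (e - 1) = Q x"
  proof -
    have "\<sigma> 1 \<star> Q x \<star> \<sigma> (e - 1) = Q x \<star> \<sigma> (1 + (e - 1))"
      by (simp only: Q_central1 ga_mult_assoc \<sigma>_mult)
    then show ?thesis
      using s(1) by (simp add: \<sigma>_e0)
  qed
  moreover have "ga_scale (of_nat e) (\<sigma> 1 \<star> x \<star> \<sigma> (e - 1))
      = \<sigma> 1 \<star> y \<star> \<sigma> (e - 1) + \<sigma> 1 \<star> Q x \<star> \<sigma> (e - 1)"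
    by (simp add: y_def ga_mult_scale_left ga_mult_scale_right
        flip: ga_mult_add_left ga_mult_add_right)
  ultimately have "ga_scale (of_nat e) (\<sigma> 1 \<star> x \<star> \<sigma> (e - 1)) \<in> L"
    using Q_L[OF x] sub by (simp add: ga.subspace_add)
  then show ?thesis
    using e by (simp add: scale_L \<sigma>_def)
qed

section \<open>Linear groups\<close>

context vector_space
begin

lemma GL_carrier: "f \<in> carrier (GL scale) \<longleftrightarrow>
    (\<forall>x y. f (x + y) = f x + f y) \<and> (\<forall>c x. f (scale c x) = scale c (f x)) \<and> bij f"
  by (simp add: GL_def Vector_Spaces.linear_iff vector_space_axioms)

lemma GL_simps: "f \<otimes>\<^bsub>GL scale\<^esub> g = f \<circ> g" "\<one>\<^bsub>GL scale\<^esub> = id"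
  by (simp_all add: GL_def)

lemma GL_inverse:
  assumes f: "f \<in> carrier (GL scale)"
  shows "inv_into UNIV f \<in> carrier (GL scale)"
proof -
  have bij: "bij f" and add: "f (x + y) = f x + f y" and sc: "f (scale c x) = scale c (f x)" for x y c
    using f by (auto simp: GL_carrier)
  have f_inv: "f (inv_into UNIV f x) = x" for x
    using bij by (simp add: bij_is_surj surj_f_inv_f)
  show ?thesis
    unfolding GL_carrier
  proof (intro conjI allI)
    show "bij (inv_into UNIV f)"
      using bij by (rule bij_imp_bij_inv)
    show "inv_into UNIV f (x + y) = inv_into UNIV f x + inv_into UNIV f y" for x y
      by (rule inv_f_eq[OF bij_is_inj[OF bij]]) (simp add: add f_inv)
    show "inv_into UNIV f (scale c x) = scale c (inv_into UNIV f x)" for c x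
      by (rule inv_f_eq[OF bij_is_inj[OF bij]]) (simp add: sc f_inv)
  qed
qed

lemma group_GL: "Group.group (GL scale)"
proof (rule groupI)
  fix x y z assume "x \<in> carrier (GL scale)" "y \<in> carrier (GL scale)" "z \<in> carrier (GL scale)"
  then show "x \<otimes>\<^bsub>GL scale\<^esub> y \<in> carrier (GL scale)"
    by (auto simp: GL_carrier GL_simps intro: bij_comp)
  show "x \<otimes>\<^bsub>GL scale\<^esub> y \<otimes>\<^bsub>GL scale\<^esub> z = x \<otimes>\<^bsub>GL scale\<^esub> (y \<otimes>\<^bsub>GL scale\<^esub> z)"
    by (simp add: GL_simps comp_assoc)
next
  show "\<one>\<^bsub>GL scale\<^esub> \<in> carrier (GL scale)"
    by (simp add: GL_carrier GL_simps)
next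
  fix x assume "x \<in> carrier (GL scale)"
  then show "\<one>\<^bsub>GL scale\<^esub> \<otimes>\<^bsub>GL scale\<^esub> x = x"
    "\<exists>y\<in>carrier (GL scale). y \<otimes>\<^bsub>GL scale\<^esub> x = \<one>\<^bsub>GL scale\<^esub>"
    using GL_inverse by (auto simp: GL_simps GL_carrier bij_is_inj inv_o_cancel intro!: bexI[of _ "inv_into UNIV x"])
qed

lemma GL_m_inv:
  assumes "f \<in> carrier (GL scale)" "g \<in> carrier (GL scale)" "g \<circ> f = id"
  shows "inv\<^bsub>GL scale\<^esub> f = g"
  using assms by (intro group.inv_equality[OF group_GL]) (auto simp: GL_simps)

lemma finite_linear_group:
  assumes "subgroup W (GL scale)" "finite W"
  shows "finite_permutation_group W"
proof
  show "id \<in> W"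
    using subgroup.one_closed[OF assms(1)] by (simp add: GL_simps)
  show "f \<circ> g \<in> W" if "f \<in> W" "g \<in> W" for f g
    using subgroup.m_closed[OF assms(1) that] by (simp add: GL_simps)
  show "bij f" if "f \<in> W" for f
    using subgroup.mem_carrier[OF assms(1) that] by (simp add: GL_carrier)
qed (rule assms)

end

text \<open>The inverse of a generator is one of its positive powers.\<close>

lemma (in vector_space) generate_subset_words:
  assumes W: "subgroup W (GL scale)" "finite W" and X: "X \<subseteq> W"
  shows "generate (GL scale) X \<subseteq> words X"
proof
  interpret finite_permutation_group W
    by (rule finite_linear_group[OF W])
  fix w assume "w \<in> generate (GL scale) X"
  then show "w \<in> words X"
  proof induction
    case one
    show ?case by (simp only: GL_simps words_id)
  next
    case (inv u)
    then obtain n where n: "n > 0" "u ^^ n = id"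
      using finite_order X by blast
    have "u ^^ (n - 1) \<circ> u = id"
      using n by (metis Suc_diff_1 funpow_Suc_right)
    moreover have "u \<in> carrier (GL scale)" "u ^^ (n - 1) \<in> carrier (GL scale)"
      using inv X power_in_W subgroup.mem_carrier[OF W(1)] by blast+
    ultimately show ?case
      using words_power[OF inv] by (simp add: GL_m_inv)
  next
    case (eng v w)
    then show ?case by (simp only: GL_simps words_closed)
  qed (rule words_incl)
qed

section \<open>Hyperplanes and semi-invariants\<close>

locale finite_dim_char_0_space = finite_dimensional_vector_space scale Basis
  for scale :: "'f::field_char_0 \<Rightarrow> 'v::ab_group_add \<Rightarrow> 'v" and Basis
begin

definition is_form :: "('v \<Rightarrow> 'f) \<Rightarrow> bool" where
  "is_form \<alpha> \<longleftrightarrow> (\<forall>x y. \<alpha> (x + y) = \<alpha> x + \<alpha> y) \<and> (\<forall>c x. \<alpha> (scale c x) = c * \<alpha> x)"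

lemma is_form_diff: "is_form \<alpha> \<Longrightarrow> \<alpha> (x - y) = \<alpha> x - \<alpha> y"
  unfolding is_form_def by (metis diff_add_cancel add_diff_cancel_right')

definition form :: "'v set \<Rightarrow> 'v \<Rightarrow> 'f" where
  "form H = (SOME \<alpha>. is_form \<alpha> \<and> {v. \<alpha> v = 0} = H \<and> (\<exists>a. \<alpha> a = 1))"

lemma hyperplane_form:
  assumes H: "hyperplane scale H"
  shows "is_form (form H)" "form H v = 0 \<longleftrightarrow> v \<in> H" "\<exists>a. form H a = 1"
proof -
  have sub: "subspace H" and dim: "Suc (dim H) = dim UNIV"
    using H by (auto simp: hyperplane_def)
  then have "H \<noteq> UNIV"
    by auto
  then obtain a where a: "a \<notin> H"
    by blast
  have "dim (insert a H) = dim UNIV"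
    using a sub dim by (simp add: dim_insert span_eq_iff[THEN iffD2])
  then have "span (insert a H) = UNIV"
    by (intro subspace_dim_equal) auto
  then have "\<exists>c. v - scale c a \<in> H" for v
    using span_breakdown_eq[of v a H] sub by (simp add: span_eq_iff[THEN iffD2])
  then obtain \<alpha> where \<alpha>: "v - scale (\<alpha> v) a \<in> H" for v
    by metis
  have unique: "c = \<alpha> v" if "v - scale c a \<in> H" for c v
  proof (rule ccontr)
    assume neq: "c \<noteq> \<alpha> v"
    have "(v - scale (\<alpha> v) a) - (v - scale c a) \<in> H"
      using \<alpha> that sub by (rule subspace_diff[rotated])
    then have "scale (c - \<alpha> v) a \<in> H"
      by (simp add: scale_left_diff_distrib)
    then have "scale (1 / (c - \<alpha> v)) (scale (c - \<alpha> v) a) \<in> H"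
      using sub by (rule subspace_scale[rotated])
    then show False
      using a neq by simp
  qed
  have "\<alpha> (x + y) = \<alpha> x + \<alpha> y" for x y
    using subspace_add[OF sub \<alpha>[of x] \<alpha>[of y]]
    by (intro unique[symmetric]) (simp add: scale_left_distrib algebra_simps)
  moreover have "\<alpha> (scale c x) = c * \<alpha> x" for c x
    using subspace_scale[OF sub \<alpha>[of x], of c]
    by (intro unique[symmetric]) (simp add: scale_right_diff_distrib)
  moreover have "\<alpha> v = 0 \<longleftrightarrow> v \<in> H" for v
    using \<alpha>[of v] unique[of v 0] by auto
  moreover have "\<alpha> a = 1"
    using sub by (intro unique[symmetric]) (simp add: subspace_0)
  ultimately have "is_form \<alpha> \<and> {v. \<alpha> v = 0} = H \<and> (\<exists>a. \<alpha> a = 1)"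
    by (auto simp: is_form_def)
  then have "is_form (form H) \<and> {v. form H v = 0} = H \<and> (\<exists>a. form H a = 1)"
    unfolding form_def by (rule someI[of "\<lambda>\<alpha>. is_form \<alpha> \<and> {v. \<alpha> v = 0} = H \<and> (\<exists>a. \<alpha> a = 1)"])
  then show "is_form (form H)" "form H v = 0 \<longleftrightarrow> v \<in> H" "\<exists>a. form H a = 1"
    by auto
qed

text \<open>A vector space over an infinite field is not a finite union of proper subspaces: starting from \<open>v\<close>,
good for the earlier forms, and \<open>w\<close>, good for the new one, all but finitely many combinations
\<open>v + t w\<close> are good for all of them.\<close>

lemma forms_common_nonzero:
  assumes "finite C" "subspace X"
    and "\<And>i. i \<in> C \<Longrightarrow> is_form (\<alpha> i)" "\<And>i. i \<in> C \<Longrightarrow> \<exists>x\<in>X. \<alpha> i x \<noteq> 0"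
  shows "\<exists>x\<in>X. \<forall>i\<in>C. \<alpha> i x \<noteq> 0"
  using assms(1,3,4)
proof (induction C rule: finite_induct)
  case empty
  then show ?case using subspace_0[OF assms(2)] by blast
next
  case (insert i C)
  then obtain v where v: "v \<in> X" "\<forall>j\<in>C. \<alpha> j v \<noteq> 0"
    by auto
  obtain w where w: "w \<in> X" "\<alpha> i w \<noteq> 0"
    using insert.prems(2)[of i] by blast
  have "finite ((\<lambda>j. - \<alpha> j v / \<alpha> j w) ` insert i C)"
    using insert.hyps by simp
  then obtain t where t: "t \<notin> (\<lambda>j. - \<alpha> j v / \<alpha> j w) ` insert i C"
    using ex_new_if_finite[OF infinite_UNIV_char_0] by blast
  have "\<alpha> j (v + scale t w) \<noteq> 0" if j: "j \<in> insert i C" for j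
  proof
    assume "\<alpha> j (v + scale t w) = 0"
    then have eq: "\<alpha> j v + t * \<alpha> j w = 0"
      using insert.prems(1)[OF j] by (simp add: is_form_def)
    show False
    proof (cases "\<alpha> j w = 0")
      case True
      then show False using eq j v(2) w(2) by auto
    next
      case False
      then have "t = - \<alpha> j v / \<alpha> j w"
        using eq by (simp add: field_simps eq_neg_iff_add_eq_0 add.commute)
      then show False using t j by blast
    qed
  qed
  moreover have "v + scale t w \<in> X"
    using v w assms(2) by (simp add: subspace_add subspace_scale)
  ultimately show ?case by blast
qed

text \<open>The polynomial function that defines the union of the hyperplanes in \<open>C\<close>. Its factors are
determined by \<open>C\<close> up to nonzero scalars.\<close>

definition arrangement_form :: "'v set set \<Rightarrow> 'v \<Rightarrow> 'f" where
  "arrangement_form C v = (\<Prod>H\<in>C. form H v)"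

context
  fixes C :: "'v set set"
  assumes C: "finite C" "\<And>H. H \<in> C \<Longrightarrow> hyperplane scale H"
begin

lemma arrangement_form_nonzero_on:
  assumes "subspace X" "\<And>H. H \<in> C \<Longrightarrow> \<not> X \<subseteq> H"
  obtains v where "v \<in> X" "arrangement_form C v \<noteq> 0"
proof -
  have "\<exists>x\<in>X. form H x \<noteq> 0" if "H \<in> C" for H
    using assms(2)[OF that] hyperplane_form(2)[OF C(2)[OF that]] by auto
  then have "\<exists>x\<in>X. \<forall>H\<in>C. form H x \<noteq> 0"
    using C hyperplane_form(1) assms(1) by (intro forms_common_nonzero) auto
  then show thesis
    using that C(1) by (auto simp: arrangement_form_def)
qed

text \<open>\<open>w\<close> permutes the hyperplanes, hence it permutes the factors up to scalars.\<close>

lemma arrangement_form_semi_invariant: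
  assumes w: "w \<in> carrier (GL scale)" and perm: "\<And>H. H \<in> C \<Longrightarrow> w ` H \<in> C"
  obtains \<chi> where "\<And>v. arrangement_form C (w v) = \<chi> * arrangement_form C v"
proof -
  have w_add: "w (x + y) = w x + w y" and w_scale: "w (scale c x) = scale c (w x)"
    and w_inj: "inj w" for x y c
    using w by (auto simp: GL_carrier bij_is_inj)
  obtain a where a: "form H (a H) = 1" if "H \<in> C" for H
    using hyperplane_form(3)[OF C(2)] by metis
  have inj: "inj_on ((`) w) C"
    using inj_on_subset[OF inj_on_image] w_inj by (metis inj_image_eq_iff inj_onI)
  have img: "(`) w ` C = C"
    using perm endo_inj_surj[OF C(1) _ inj] by blast
  have form_w: "form (w ` H) (w v) = form (w ` H) (w (a H)) * form H v" if H: "H \<in> C" for H v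
  proof -
    have "form H (v - scale (form H v) (a H)) = 0"
      using hyperplane_form(1)[OF C(2)[OF H]] a[OF H] by (simp add: is_form_diff) (simp add: is_form_def)
    then have "form (w ` H) (w (v - scale (form H v) (a H))) = 0"
      using hyperplane_form(2) C(2) perm H by blast
    moreover have "w v = w (v - scale (form H v) (a H)) + scale (form H v) (w (a H))"
      by (simp flip: w_add w_scale)
    ultimately show ?thesis
      using hyperplane_form(1)[OF C(2)[OF perm[OF H]]] by (simp add: is_form_def)
  qed
  show thesis
  proof (rule that)
    fix v
    have "arrangement_form C (w v) = (\<Prod>H\<in>C. form (w ` H) (w v))"
      unfolding arrangement_form_def
      by (subst img[symmetric], subst prod.reindex[OF inj]) simp
    also have "\<dots> = (\<Prod>H\<in>C. form (w ` H) (w (a H))) * arrangement_form C v"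
      unfolding arrangement_form_def prod.distrib[symmetric]
      by (intro prod.cong refl form_w)
    finally show "arrangement_form C (w v)
      = (\<Prod>H\<in>C. form (w ` H) (w (a H))) * arrangement_form C v" .
  qed
qed

text \<open>\<open>s\<close> acts by a scalar, which can be read off at a point of its hyperplane \<open>K\<close> where \<open>arrangement_form C\<close> is
nonzero. Such a point exists because \<open>K\<close> is different from all hyperplanes in \<open>C\<close>.\<close>

lemma arrangement_form_invariant:
  assumes s: "s \<in> carrier (GL scale)" and perm: "\<And>H. H \<in> C \<Longrightarrow> s ` H \<in> C"
    and K: "hyperplane scale K" "K \<notin> C" "\<And>v. v \<in> K \<Longrightarrow> s v = v"
  shows "arrangement_form C (s v) = arrangement_form C v"
proof -
  have "\<not> K \<subseteq> H" if "H \<in> C" for H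
  proof
    assume "K \<subseteq> H"
    then have "K = H"
      using K(1) C(2)[OF that] by (intro subspace_dim_equal) (auto simp: hyperplane_def)
    then show False using that K(2) by simp
  qed
  then obtain v0 where v0: "v0 \<in> K" "arrangement_form C v0 \<noteq> 0"
    using K(1) by (auto simp: hyperplane_def elim: arrangement_form_nonzero_on)
  obtain \<chi> where \<chi>: "\<And>v. arrangement_form C (s v) = \<chi> * arrangement_form C v"
    using arrangement_form_semi_invariant[OF s perm] by metis
  have "\<chi> = 1"
    using \<chi>[of v0] v0 K(3) by simp
  then show ?thesis using \<chi> by simp
qed

end

lemma form_of_fixing:
  assumes H: "hyperplane scale H" and a: "form H a = 1"
    and s: "s \<in> carrier (GL scale)" "\<And>v. v \<in> H \<Longrightarrow> s v = v"
  shows "form H (s v) = form H (s a) * form H v"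
proof -
  have "form H (v - scale (form H v) a) = 0"
    using hyperplane_form(1)[OF H] a by (simp add: is_form_diff) (simp add: is_form_def)
  then have h: "v - scale (form H v) a \<in> H"
    using hyperplane_form(2)[OF H] by blast
  have "s v = s (v - scale (form H v) a) + scale (form H v) (s a)"
    using s(1) unfolding GL_carrier by (metis diff_add_cancel)
  also have "s (v - scale (form H v) a) = v - scale (form H v) a"
    by (rule s(2)[OF h])
  finally have "form H (s v) = form H (v - scale (form H v) a) + form H v * form H (s a)"
    using hyperplane_form(1)[OF H] by (simp add: is_form_def)
  then show ?thesis
    using hyperplane_form(2)[OF H] h by simp
qed

text \<open>Split off the factor of \<open>K\<close>; the product of the others is invariant.\<close>

lemma arrangement_form_reflection:
  assumes C: "finite C" "\<And>H. H \<in> C \<Longrightarrow> hyperplane scale H"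
    and s: "s \<in> carrier (GL scale)" and perm: "\<And>H. H \<in> C \<Longrightarrow> s ` H \<in> C"
    and K: "K \<in> C" "\<And>v. v \<in> K \<Longrightarrow> s v = v"
    and a: "form K a = 1"
  shows "arrangement_form C (s v) = form K (s a) * arrangement_form C v"
proof -
  have split: "arrangement_form C v = form K v * arrangement_form (C - {K}) v" for v
    using C(1) K(1) by (simp add: arrangement_form_def prod.remove)
  have sK: "s ` K = K"
    using K(2) by (simp add: image_def)
  have inj: "inj s"
    using s by (simp add: GL_carrier bij_is_inj)
  have perm': "s ` H \<in> C - {K}" if "H \<in> C - {K}" for H
  proof -
    have "s ` H \<noteq> s ` K"
      using that inj_image_eq_iff[OF inj, of H K] by simp
    then show ?thesis
      using perm[of H] that sK by simp
  qed
  have "arrangement_form (C - {K}) (s v) = arrangement_form (C - {K}) v"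
    using C K by (intro arrangement_form_invariant[OF _ _ s perm', of K]) auto
  then show ?thesis
    using form_of_fixing[OF C(2)[OF K(1)] a s K(2), of v] by (simp only: split mult.assoc)
qed

text \<open>Otherwise \<open>t\<close> translates \<open>a\<close> by a nonzero vector \<open>h\<close> of \<open>H\<close> that it fixes, so \<open>t^n\<close> translates \<open>a\<close> by \<open>n h\<close>, which
is nonzero in characteristic 0.\<close>

lemma finite_order_transvection_trivial:
  assumes H: "hyperplane scale H" and a: "form H a = 1"
    and t: "t \<in> carrier (GL scale)" "\<And>v. v \<in> H \<Longrightarrow> t v = v"
    and ta: "form H (t a) = 1" and n: "n > 0" "t ^^ n = id"
  shows "t = id"
proof -
  have t_add: "t (x + y) = t x + t y" and t_scale: "t (scale c x) = scale c (t x)" for x y c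
    using t by (auto simp: GL_carrier)
  define h where "h = t a - a"
  have "form H h = 0"
    using hyperplane_form(1)[OF H] by (simp add: h_def is_form_diff a ta)
  then have "h \<in> H"
    using hyperplane_form(2)[OF H] by blast
  then have th: "t h = h"
    by (rule t(2))
  have "(t ^^ k) a = a + scale (of_nat k) h" for k
  proof (induction k)
    case (Suc k)
    have "t a = a + h" by (simp add: h_def)
    then show ?case
      using Suc th by (simp add: t_add t_scale scale_left_distrib add.assoc add.commute)
  qed simp
  from this[of n] have "h = 0"
    using n by simp
  show ?thesis
  proof
    fix v
    have "form H (v - scale (form H v) a) = 0"
      using hyperplane_form(1)[OF H] a by (simp add: is_form_diff) (simp add: is_form_def)
    then have "t (v - scale (form H v) a) = v - scale (form H v) a"
      using hyperplane_form(2)[OF H] t(2) by blast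
    moreover have "t (scale (form H v) a) = scale (form H v) a"
      using \<open>h = 0\<close> by (simp add: t_scale h_def)
    ultimately show "t v = id v"
      using t_add[of "v - scale (form H v) a" "scale (form H v) a"] by simp
  qed
qed

text \<open>The space fixed by a pseudo-reflection contains a hyperplane and is not the whole space.\<close>

lemma hyperplane_fixed_space:
  assumes "pseudo_reflection scale s"
  shows "hyperplane scale (fixed_space s)"
proof -
  obtain H where H: "hyperplane scale H" "\<forall>v\<in>H. s v = v"
    and s: "s \<in> carrier (GL scale)" "s \<noteq> id"
    using assms by (auto simp: pseudo_reflection_def)
  have "s 0 = 0"
    using s(1) unfolding GL_carrier by (metis scale_zero_left)
  then have sub: "subspace (fixed_space s)"
    using s(1) by (intro subspaceI) (simp_all add: fixed_space_def GL_carrier)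
  have "fixed_space s \<noteq> UNIV"
    using s(2) by (auto simp: fixed_space_def fun_eq_iff)
  then have "dim (fixed_space s) < dim (UNIV :: 'v set)"
    using subspace_dim_equal[OF sub subspace_UNIV] dim_subset_UNIV[of "fixed_space s"] by fastforce
  then have "H = fixed_space s"
    using H sub by (intro subspace_dim_equal) (auto simp: hyperplane_def fixed_space_def)
  then show ?thesis using H(1) by simp
qed

end

section \<open>Reflections as conjugates of powers of generators\<close>

lemma fixed_space_conjugate:
  fixes w w' s :: "'v::ab_group_add \<Rightarrow> 'v"
  assumes "w \<circ> w' = id" "w' \<circ> w = id"
  shows "fixed_space (w \<circ> s \<circ> w') = w ` fixed_space s"
proof -
  have ww': "w (w' v) = v" "w' (w v) = v" for v
    using assms by (metis comp_apply id_apply)+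
  show ?thesis
  proof (intro equalityI subsetI)
    fix v assume "v \<in> fixed_space (w \<circ> s \<circ> w')"
    then have "w (s (w' v)) = v"
      by (simp add: fixed_space_def)
    then have "s (w' v) = w' v"
      using ww'(2)[of "s (w' v)"] by simp
    then show "v \<in> w ` fixed_space s"
      using ww'(1)[of v] by (intro image_eqI[of _ _ "w' v"]) (simp_all add: fixed_space_def)
  qed (auto simp: fixed_space_def ww')
qed

context finite_dim_char_0_space
begin

text \<open>The scalar by which an element of \<open>W\<close> acts on the arrangement form of the orbit of \<open>fixed_space r\<close> is a
linear character of \<open>W\<close>. On \<open>U\<close> it takes only the values 1 and \<open>\<delta>\<close>, the eigenvalue of the element \<open>s\<close>
of \<open>S\<close> with the same hyperplane as \<open>r\<close>; so the eigenvalue of \<open>r\<close> is \<open>\<delta> ^ m\<close> for some \<open>m\<close>, and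
\<open>r\<close> equals \<open>s ^^ m\<close>. As \<open>r\<close> is not the identity, \<open>m\<close> is not 0, so some \<open>u\<close> in \<open>U\<close> has its
hyperplane in the orbit, and this \<open>u\<close> is a conjugate of \<open>s\<close>.\<close>

lemma reflection_conjugate_to_generator_power:
  assumes W: "subgroup W (GL scale)" "finite W"
    and S: "S \<subseteq> reflections scale W" "conj_stable scale W S"
      "bij_betw fixed_space S (reflecting_hyperplanes scale W)"
    and U: "U \<subseteq> S" "generate (GL scale) U = W"
    and r: "r \<in> reflections scale W"
  obtains w w' u m where "w \<in> W" "w' \<in> W" "w \<circ> w' = id" "w' \<circ> w = id" "u \<in> U"
    "r = w \<circ> u ^^ m \<circ> w'"
proof -
  interpret finite_permutation_group W
    by (rule finite_linear_group[OF W])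
  have U_W: "U \<subseteq> W"
    using U S by (auto simp: reflections_def)
  then have W_words: "W \<subseteq> words U"
    using generate_subset_words[OF W, of U] U by simp
  have W_GL: "w \<in> carrier (GL scale)" if "w \<in> W" for w
    using subgroup.mem_carrier[OF W(1) that] .
  have hyp: "hyperplane scale (fixed_space q)" if "q \<in> reflections scale W" for q
    using that by (intro hyperplane_fixed_space) (simp add: reflections_def)
  define K where "K = fixed_space r"
  have K: "hyperplane scale K"
    using hyp[OF r] by (simp add: K_def)
  have "K \<in> fixed_space ` S"
    using S(3) r by (simp add: bij_betw_def reflecting_hyperplanes_def K_def)
  then obtain s where s: "s \<in> S" "fixed_space s = K"
    by blast
  then have sW: "s \<in> W"
    using S(1) by (auto simp: reflections_def)
  obtain a where a: "form K a = 1"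
    using hyperplane_form(3)[OF K] by blast
  define \<delta> where "\<delta> = form K (s a)"

  have conj_S: "w \<circ> s \<circ> w' \<in> S" if "w \<in> W" "w' \<in> W" "w' \<circ> w = id" for w w'
    using S(2) s(1) that GL_m_inv[OF W_GL W_GL, of w w']
    by (auto simp: conj_stable_def GL_simps)

  define C where "C = (\<lambda>w. w ` K) ` W"
  have "finite C"
    by (simp add: C_def W(2))
  have C_hyp: "hyperplane scale H" if "H \<in> C" for H
  proof -
    obtain w where w: "w \<in> W" "H = w ` K"
      using \<open>H \<in> C\<close> by (auto simp: C_def)
    obtain w' where w': "w' \<in> W" "w' \<circ> w = id" "w \<circ> w' = id"
      using inverse_in_W[OF w(1)] .
    have "H = fixed_space (w \<circ> s \<circ> w')"
      using fixed_space_conjugate[OF w'(3,2)] s(2) w(2) by simp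
    then show ?thesis
      using hyp conj_S[OF w(1) w'(1,2)] S(1) by auto
  qed
  have perm: "w ` H \<in> C" if "w \<in> W" "H \<in> C" for w H
  proof -
    obtain v where "v \<in> W" "H = v ` K"
      using \<open>H \<in> C\<close> by (auto simp: C_def)
    then have "w ` H = (w \<circ> v) ` K" "w \<circ> v \<in> W"
      using that comp_in_W by (auto simp: image_comp)
    then show ?thesis
      unfolding C_def by blast
  qed
  have "K \<in> C"
    unfolding C_def using id_in_W by (intro image_eqI[of _ _ id]) simp_all

  let ?F = "arrangement_form C"
  have "\<not> UNIV \<subseteq> H" if "H \<in> C" for H
  proof
    assume "UNIV \<subseteq> H"
    then have "H = UNIV" by blast
    then show False
      using C_hyp[OF that] by (simp add: hyperplane_def)
  qed
  then obtain v\<^sub>0 where v0: "?F v\<^sub>0 \<noteq> 0"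
    using arrangement_form_nonzero_on[OF \<open>finite C\<close> C_hyp subspace_UNIV] by blast

  have fix_K: "q v = v" if "fixed_space q = H" "v \<in> H" for q H v
    using that by (auto simp: fixed_space_def)

  have F_s: "?F (s v) = \<delta> * ?F v" for v
    unfolding \<delta>_def
    using arrangement_form_reflection[OF \<open>finite C\<close> C_hyp W_GL[OF sW] perm[OF sW] \<open>K \<in> C\<close>
        fix_K[OF s(2)] a] .

  have F_conj: "?F (u v) = \<delta> * ?F v" if u: "u = w \<circ> s \<circ> w'" and w: "w \<in> W" "w \<circ> w' = id" for u w w' v
  proof -
    obtain \<chi> where \<chi>: "\<And>v. ?F (w v) = \<chi> * ?F v"
      using arrangement_form_semi_invariant[OF \<open>finite C\<close> C_hyp W_GL[OF w(1)] perm[OF w(1)]]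
      by metis
    have "?F v = \<chi> * ?F (w' v)"
      using w(2) \<chi>[of "w' v"] by (metis comp_apply id_apply)
    then show ?thesis
      by (simp add: u \<chi> F_s)
  qed

  have U_C: "\<exists>w w'. w \<in> W \<and> w' \<in> W \<and> w \<circ> w' = id \<and> w' \<circ> w = id \<and> u = w \<circ> s \<circ> w'"
    if u: "u \<in> U" "fixed_space u \<in> C" for u
  proof -
    obtain w where w: "w \<in> W" "fixed_space u = w ` K"
      using u(2) by (auto simp: C_def)
    obtain w' where w': "w' \<in> W" "w' \<circ> w = id" "w \<circ> w' = id"
      using inverse_in_W[OF w(1)] .
    have "fixed_space (w \<circ> s \<circ> w') = fixed_space u"
      using fixed_space_conjugate[OF w'(3,2)] s(2) w(2) by simp
    then have "w \<circ> s \<circ> w' = u"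
      using S(3) conj_S[OF w(1) w'(1,2)] u(1) U(1)
      by (auto simp: bij_betw_def dest: inj_onD)
    then show ?thesis
      using w w' by blast
  qed

  have F_U: "?F (u v) = ?F v" if u: "u \<in> U" "fixed_space u \<notin> C" for u v
  proof -
    have uW: "u \<in> W" and uR: "u \<in> reflections scale W"
      using u U S U_W by auto
    show ?thesis
      using arrangement_form_invariant[OF \<open>finite C\<close> C_hyp W_GL[OF uW] perm[OF uW] hyp[OF uR]
          u(2) fix_K[of u, OF refl]] .
  qed

  \<comment> \<open>The first conjunct records that a nontrivial power of \<open>\<delta>\<close> can only come from an element of \<open>U\<close>
  whose hyperplane lies in the orbit.\<close>
  have power: "\<exists>m. (m = 0 \<or> (\<exists>u\<in>U. fixed_space u \<in> C)) \<and> (\<forall>v. ?F (w v) = \<delta> ^ m * ?F v)"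
    if "w \<in> words U" for w
    using that
  proof induction
    case words_id
    show ?case by (rule exI[of _ 0]) simp
  next
    case (words_comp u w)
    then obtain m where m: "m = 0 \<or> (\<exists>u\<in>U. fixed_space u \<in> C)" "\<And>v. ?F (w v) = \<delta> ^ m * ?F v"
      by blast
    show ?case
    proof (cases "fixed_space u \<in> C")
      case True
      then have "?F (u v) = \<delta> * ?F v" for v
        using U_C[OF words_comp.hyps(1)] F_conj by blast
      then show ?thesis
        using m(2) True words_comp.hyps(1) by (intro exI[of _ "Suc m"]) auto
    next
      case False
      then show ?thesis
        using m F_U[OF words_comp.hyps(1)] by (intro exI[of _ m]) simp
    qed
  qed

  have rW: "r \<in> W" and r_id: "r \<noteq> id"
    using r by (auto simp: reflections_def pseudo_reflection_def)
  have r_K: "r v = v" if "v \<in> K" for v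
    using fix_K[of r K v] that by (simp add: K_def)
  obtain m where m: "m = 0 \<or> (\<exists>u\<in>U. fixed_space u \<in> C)" "\<And>v. ?F (r v) = \<delta> ^ m * ?F v"
    using power[of r] rW W_words by blast
  have "?F (r v\<^sub>0) = form K (r a) * ?F v\<^sub>0"
    using arrangement_form_reflection[OF \<open>finite C\<close> C_hyp W_GL[OF rW] perm[OF rW] \<open>K \<in> C\<close> r_K a] .
  then have r_\<delta>: "form K (r a) = \<delta> ^ m"
    using m(2)[of v\<^sub>0] v0 by simp

  obtain r' where r': "r' \<in> W" "r' \<circ> r = id" "r \<circ> r' = id"
    using inverse_in_W[OF rW] .
  have s_K: "s v = v" if "v \<in> K" for v
    using fix_K[OF s(2) that] .
  have sm_K: "(s ^^ k) v = v" if "v \<in> K" for v k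
    using that by (induction k) (simp_all add: s_K)
  have sm_form: "form K ((s ^^ k) v) = \<delta> ^ k * form K v" for k v
    by (induction k)
      (simp_all add: form_of_fixing[OF K a W_GL[OF sW] s_K, of "(s ^^ _) v"] flip: \<delta>_def)

  \<comment> \<open>\<open>t\<close> fixes \<open>K\<close> pointwise and has eigenvalue 1 on the quotient by \<open>K\<close>, so finite order makes it trivial.\<close>
  define t where "t = r' \<circ> s ^^ m"
  have tW: "t \<in> W"
    by (simp add: t_def comp_in_W r' power_in_W sW)
  have r'r: "r' (r v) = v" "r (r' v) = v" for v
    using r' by (metis comp_apply id_apply)+
  have t_K: "t v = v" if "v \<in> K" for v
    using r'r(1)[of v] by (simp add: t_def sm_K r_K that)
  have "\<delta> ^ m * form K (t a) = form K (r (t a))"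
    using form_of_fixing[OF K a W_GL[OF rW] r_K, of "t a"] r_\<delta> by simp
  also have "\<dots> = \<delta> ^ m"
    using sm_form[of m a] by (simp add: t_def r'r a)
  finally have "form K (t a) = 1 \<or> \<delta> ^ m = 0"
    by auto
  moreover have "\<delta> ^ m \<noteq> 0"
  proof
    assume "\<delta> ^ m = 0"
    then have "form K v = 0" for v
      using form_of_fixing[OF K a W_GL[OF rW] r_K, of "r' v"] r_\<delta> r'r by simp
    then show False using a by simp
  qed
  ultimately have ta: "form K (t a) = 1" by blast
  obtain n where n: "n > 0" "t ^^ n = id"
    using finite_order[OF tW] .
  have "t = id"
    using finite_order_transvection_trivial[OF K a W_GL[OF tW] t_K ta n] .
  then have "r \<circ> t = r" by simp
  then have r_s: "r = s ^^ m"
    using r'(3) by (simp add: t_def flip: comp_assoc)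
  then obtain u where u: "u \<in> U" "fixed_space u \<in> C"
    using m(1) r_id by (metis funpow_0 ext id_apply)
  obtain w w' where w: "w \<in> W" "w' \<in> W" "w \<circ> w' = id" "w' \<circ> w = id" "u = w \<circ> s \<circ> w'"
    using U_C[OF u] by blast
  have w'w: "w' (w v) = v" for v
    using w(4) by (metis comp_apply id_apply)
  have uw: "u (w x) = w (s x)" for x
    by (simp add: w(5) w'w)
  have "(u ^^ k) (w v) = w ((s ^^ k) v)" for k v
    by (induction k) (simp_all add: uw)
  then have "(w' \<circ> u ^^ k \<circ> w) v = (s ^^ k) v" for k v
    by (simp add: w'w)
  then have "r = w' \<circ> u ^^ m \<circ> w"
    using r_s by auto
  then show thesis
    using that[OF w(2,1,4,3) u(1)] by blast
qed

end

section \<open>The Lie algebra generated by powers of generators\<close>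

theorem theorem3:
  fixes scale :: "complex \<Rightarrow> 'v::ab_group_add \<Rightarrow> 'v"
    and Basis :: "'v set"
    and W S U :: "('v \<Rightarrow> 'v) set"
  assumes "finite_dimensional_vector_space scale Basis"
    and "reflection_group scale W"
    and "irreducible_group scale W"
    and "\<not> two_reflection_group scale W"
    and "S \<subseteq> reflections scale W"
    and "conj_stable scale W S"
    and "bij_betw fixed_space S (reflecting_hyperplanes scale W)"
    and "U \<subseteq> S"
    and "generate (GL scale) U = W"
  shows "ga.reductive (lie_closure_in_group_algebra W U :: (('v \<Rightarrow> 'v) \<Rightarrow>\<^sub>0 'k::field_char_0) set)
    \<and> ga.reductive (lie_closure_in_group_algebra W (nontrivial_powers U) :: (('v \<Rightarrow> 'v) \<Rightarrow>\<^sub>0 'k) set)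
    \<and> ga.derived (lie_closure_in_group_algebra W (nontrivial_powers U) :: (('v \<Rightarrow> 'v) \<Rightarrow>\<^sub>0 'k) set)
      = ga.derived (lie_closure_in_group_algebra W (reflections scale W))"
proof -
  interpret finite_dim_char_0_space scale Basis
    using assms(1) by (rule finite_dim_char_0_space.intro)
  have W: "subgroup W (GL scale)" "finite W"
    using assms(2) by (auto simp: reflection_group_def)
  interpret finite_permutation_group W
    by (rule finite_linear_group[OF W])
  let ?A = "group_algebra W :: (('v \<Rightarrow> 'v) \<Rightarrow>\<^sub>0 'k) set"
  let ?H = "\<lambda>X. lie_closure_in_group_algebra W X :: (('v \<Rightarrow> 'v) \<Rightarrow>\<^sub>0 'k) set"
  let ?P = "nontrivial_powers U" and ?R = "reflections scale W"
  have H: "ga.lie_subalgebra (?H X)" "gelem ` X \<subseteq> ?H X" "?H X \<subseteq> ?A" if "X \<subseteq> W" for X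
  proof -
    have "gelem ` X \<subseteq> ?A"
      using that by auto
    then show "ga.lie_subalgebra (?H X)" "gelem ` X \<subseteq> ?H X" "?H X \<subseteq> ?A"
      using ga.lie_generated_subalgebra[OF lie_subalgebra_group_algebra[OF comp_in_W]]
      unfolding lie_closure_in_group_algebra_def by blast+
  qed
  have H_min: "?H X \<subseteq> L" if "ga.lie_subalgebra L" "L \<subseteq> ?A" "gelem ` X \<subseteq> L" for X L
    using ga.lie_generated_minimal[OF that] unfolding lie_closure_in_group_algebra_def .
  have R_W: "?R \<subseteq> W"
    by (auto simp: reflections_def)
  then have U_W: "U \<subseteq> W"
    using assms(5,8) by blast
  have W_words: "W \<subseteq> words U"
    using generate_subset_words[OF W U_W] assms(9) by simp
  have U_P: "U \<subseteq> ?P"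
  proof
    fix u assume "u \<in> U"
    moreover have "u \<noteq> id"
      using \<open>u \<in> U\<close> assms(5,8) by (auto simp: reflections_def pseudo_reflection_def)
    ultimately show "u \<in> ?P"
      unfolding nontrivial_powers_def by (intro CollectI exI[of _ u] exI[of _ 1]) simp
  qed
  have P_W: "?P \<subseteq> W"
    using U_W power_in_W unfolding nontrivial_powers_def by blast
  have reductive: "ga.reductive (?H X)" if X: "X \<subseteq> W" "W \<subseteq> words X" for X
  proof -
    interpret generated_permutation_group W X
      by unfold_locales (rule X)+
    show ?thesis
      using H[OF X(1)] by (intro reductive_if_generates)
  qed
  have P_R: "?P \<subseteq> ?R"
  proof
    fix g assume "g \<in> ?P"
    then obtain u k where u: "g = u ^^ k" "u \<in> U" "g \<noteq> id"
      by (auto simp: nontrivial_powers_def)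
    then obtain K where K: "hyperplane scale K" "\<forall>v\<in>K. u v = v"
      using assms(5,8) by (auto simp: reflections_def pseudo_reflection_def)
    have "\<forall>v\<in>K. (u ^^ k) v = v" for k
      by (induction k) (use K in auto)
    moreover have "g \<in> W"
      using \<open>g \<in> ?P\<close> P_W by blast
    ultimately show "g \<in> ?R"
      using K u subgroup.mem_carrier[OF W(1)]
      by (auto simp: reflections_def pseudo_reflection_def)
  qed
  \<comment> \<open>Each generator conjugates \<open>?H ?P\<close> into itself, and hence so does every element of \<open>W\<close>.\<close>
  have conj: "\<exists>w'. w \<circ> w' = id \<and> w' \<circ> w = id \<and> (\<forall>x\<in>?H ?P. gelem w \<star> x \<star> gelem w' \<in> ?H ?P)"
    if "w \<in> words U" for w
    using that
  proof induction
    case words_id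
    have "gelem id \<star> x \<star> gelem id \<in> ?H ?P" if "x \<in> ?H ?P" for x
      using that by (simp only: ga_mult_id_left ga_mult_id_right)
    then show ?case
      by (intro exI[of _ id] conjI ballI comp_id)
  next
    case (words_comp u w)
    then obtain w' where w': "w \<circ> w' = id" "w' \<circ> w = id"
      "\<And>x. x \<in> ?H ?P \<Longrightarrow> gelem w \<star> x \<star> gelem w' \<in> ?H ?P"
      by blast
    obtain e where e: "e > 0" "u ^^ e = id"
      using finite_order words_comp.hyps(1) U_W by blast
    define u' where "u' = u ^^ (e - 1)"
    have u': "u \<circ> u' = id" "u' \<circ> u = id"
      using e unfolding u'_def
      by (metis Suc_diff_1 funpow.simps(2), metis Suc_diff_1 funpow_Suc_right)
    have u_stable: "gelem u \<star> x \<star> gelem u' \<in> ?H ?P" if "x \<in> ?H ?P" for x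
      unfolding u'_def
    proof (rule conjugation_by_cyclic_group[OF H(1)[OF P_W] e _ that])
      show "gelem (u ^^ k) \<in> ?H ?P" if "u ^^ k \<noteq> id" for k
        using H(2)[OF P_W] that words_comp.hyps(1) by (auto simp: nontrivial_powers_def)
    qed
    have "(u \<circ> w) \<circ> (w' \<circ> u') = id" "(w' \<circ> u') \<circ> (u \<circ> w) = id"
      using u' w'(1,2) by (metis comp_assoc comp_id id_comp)+
    moreover have "gelem (u \<circ> w) \<star> x \<star> gelem (w' \<circ> u') \<in> ?H ?P" if "x \<in> ?H ?P" for x
      using u_stable[OF w'(3)[OF that]] by (simp only: ga_mult_assoc flip: gelem_mult)
    ultimately show ?case by blast
  qed
  have "gelem r \<in> ?H ?P" if r: "r \<in> ?R" for r
  proof -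
    obtain w w' u m where w: "w \<in> W" "w' \<in> W" "w \<circ> w' = id" "w' \<circ> w = id" "u \<in> U"
      and r_eq: "r = w \<circ> u ^^ m \<circ> w'"
      using reflection_conjugate_to_generator_power[OF W assms(5-9) r] .
    obtain w'' where w'': "w \<circ> w'' = id" "w'' \<circ> w = id"
      "\<And>x. x \<in> ?H ?P \<Longrightarrow> gelem w \<star> x \<star> gelem w'' \<in> ?H ?P"
      using conj[of w] w(1) W_words by blast
    have "w'' = w'"
      using w(4) w''(1) by (metis comp_assoc comp_id id_comp)
    moreover have "u ^^ m \<noteq> id"
    proof
      assume "u ^^ m = id"
      then have "r = id"
        using r_eq w(3) by (simp only: comp_id)
      then show False
        using r by (auto simp: reflections_def pseudo_reflection_def)
    qed
    then have "u ^^ m \<in> ?P"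
      using w(5) by (auto simp: nontrivial_powers_def)
    then have "gelem (u ^^ m) \<in> ?H ?P"
      using H(2)[OF P_W] by blast
    ultimately show ?thesis
      using w''(3) unfolding r_eq by (metis gelem_mult)
  qed
  then have "?H ?R \<subseteq> ?H ?P"
    by (intro H_min H P_W) auto
  moreover have "?H ?P \<subseteq> ?H ?R"
    using H(2)[OF R_W] P_R by (intro H_min H R_W) auto
  ultimately have "?H ?P = ?H ?R" by simp
  then show ?thesis
    using reductive[OF U_W W_words] reductive[OF P_W] W_words words_mono[OF U_P] by auto
qed

end
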